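(* Let $c\ge 0$. (i) Let $G\in \mathrm{Inf}(\mathbb{D})$. Then $$G\in \mathcal{K}(\mathbb{D},c)\quad\Longleftrightarrow\quad |G(z)|_{\mathbb{D},z}\le c\cdot R_{\mathbb{D}}(z)^2\ \text{ for all } z\in\mathbb{D}.$$ (ii) Let $H\in \mathrm{Inf}(\mathbb{H})$. Then $$H\in \mathcal{K}(\mathbb{H},c)\quad\Longleftrightarrow\quad |H(z)|_{\mathbb{H},z}\le c\cdot R_{\mathbb{H}}(z)^2\ \text{ for all } z\in\mathbb{H}.$$
   Context: $\mathbb{D}=\{z\in\mathbb{C}: |z|<1\}$ and $\mathbb{H}=\{z\in\mathbb{C}: \operatorname{Im} z>0\}$. For a domain $\Omega$ (here $\mathbb{D}$ or $\mathbb{H}$), a continuous one-real-parameter semigroup on $\Omega$ is a family $\{\Phi_t\}_{t\ge0}$ of holomorphic maps $\Phi_t:\Omega\to\Omega$ with $\Phi_0=\mathrm{id}$, $\Phi_{t+s}=\Phi_t\circ\Phi_s$ for all $s,t\ge0$, and $\Phi_t\to\mathrm{id}$ locally uniformly as $t\to0$. Its infinitesimal generator is the holomorphic map $G(z)=\lim_{t\to0}(\Phi_t(z)-z)/t$. $\mathrm{Inf}(\Omega)$ denotes the set of all infinitesimal generators of such semigroups on $\Omega$. $\mathfrak{P}$ denotes the set of all univalent (injective holomorphic) $f:\mathbb{H}\to\mathbb{H}$ with hydrodynamic normalization at $\infty$, i.e. having an expansion $f(z)=z-\frac{c_f}{z}+\gamma(z)$ with $c_f\ge0$ and $z\gamma(z)\to0$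 as $z\to\infty$ non-tangentially in $\mathbb{H}$ (i.e. within each sector $\{\delta<\arg z<\pi-\delta\}$, $\delta>0$). One writes $l(f)=c_f$. If $H$ is the generator of a semigroup $\{\Phi_t\}_{t\ge0}$ contained in $\mathfrak{P}$, one sets $l(H):=l(\Phi_1)$. $\mathcal{K}(\mathbb{H},c)$ is the set of all infinitesimal generators $H$ of semigroups $\{\Phi_t\}_{t\ge0}$ contained in $\mathfrak{P}$ with $l(H)\le c$. With the Cayley map $C:\mathbb{H}\to\mathbb{D}$, $C(z)=\frac{z-i}{z+i}$, one defines $\mathcal{K}(\mathbb{D},c)=\{\,C'(C^{-1})\cdot (H\circ C^{-1}) : H\in\mathcal{K}(\mathbb{H},c)\,\}$. Hyperbolic lengths: $|v|_{\mathbb{D},z}=\frac{2|v|}{1-|z|^2}$ for $z\in\mathbb{D}$, $v\in\mathbb{C}$, and $|v|_{\mathbb{H},z}=\frac{|v|}{\operatorname{Im} z}$ for $z\in\mathbb{H}$, $v\in\mathbb{C}$. Horodisc radii: $R_{\mathbb{D}}(z)=\frac{|1-z|^2}{1-|z|^2}$ for $z\in\mathbb{D}$ and $R_{\mathbb{H}}(z)=\frac1{\operatorname{Im} z}$ for $z\in\mathbb{H}$. *)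

theory Defs
  imports "HOL-Complex_Analysis.Complex_Analysis"
begin

abbreviation unit_disc :: "complex set" where
  "unit_disc \<equiv> {z. norm z < 1}"

abbreviation upper_half :: "complex set" where
  "upper_half \<equiv> {z. Im z > 0}"

text \<open>Maps on a domain are total functions on \<^typ>\<open>complex\<close> of which only the values on the
  domain matter; only the parameters \<open>t \<ge> 0\<close> of a family matter.\<close>

definition continuous_semigroup :: "complex set \<Rightarrow> (real \<Rightarrow> complex \<Rightarrow> complex) \<Rightarrow> bool" where
  "continuous_semigroup \<Omega> \<Phi> \<longleftrightarrow>
     (\<forall>t\<ge>0. \<Phi> t holomorphic_on \<Omega> \<and> \<Phi> t ` \<Omega> \<subseteq> \<Omega>) \<and>
     (\<forall>z\<in>\<Omega>. \<Phi> 0 z = z) \<and>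
     (\<forall>s\<ge>0. \<forall>t\<ge>0. \<forall>z\<in>\<Omega>. \<Phi> (t + s) z = \<Phi> t (\<Phi> s z)) \<and>
     (\<forall>K. compact K \<and> K \<subseteq> \<Omega> \<longrightarrow> uniform_limit K \<Phi> (\<lambda>z. z) (at_right 0))"

definition is_generator ::
    "complex set \<Rightarrow> (real \<Rightarrow> complex \<Rightarrow> complex) \<Rightarrow> (complex \<Rightarrow> complex) \<Rightarrow> bool" where
  "is_generator \<Omega> \<Phi> G \<longleftrightarrow>
     G holomorphic_on \<Omega> \<and>
     (\<forall>z\<in>\<Omega>. ((\<lambda>t. (\<Phi> t z - z) / of_real t) \<longlongrightarrow> G z) (at_right 0))"

definition Inf_gen :: "complex set \<Rightarrow> (complex \<Rightarrow> complex) set" where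
  "Inf_gen \<Omega> = {G. \<exists>\<Phi>. continuous_semigroup \<Omega> \<Phi> \<and> is_generator \<Omega> \<Phi> G}"

definition nontangential_at_infinity :: "real \<Rightarrow> complex filter" where
  "nontangential_at_infinity \<delta> = inf at_infinity (principal {z. \<delta> < Arg z \<and> Arg z < pi - \<delta>})"

definition hydrodynamic_expansion :: "(complex \<Rightarrow> complex) \<Rightarrow> real \<Rightarrow> bool" where
  "hydrodynamic_expansion f c \<longleftrightarrow>
     c \<ge> 0 \<and>
     (\<exists>\<gamma>. (\<forall>z\<in>upper_half. f z = z - of_real c / z + \<gamma> z) \<and>
          (\<forall>\<delta>>0. ((\<lambda>z. z * \<gamma> z) \<longlongrightarrow> 0) (nontangential_at_infinity \<delta>)))"

definition hydrodynamic_maps :: "(complex \<Rightarrow> complex) set" where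
  "hydrodynamic_maps =
     {f. f holomorphic_on upper_half \<and> inj_on f upper_half \<and> f ` upper_half \<subseteq> upper_half \<and>
         (\<exists>c. hydrodynamic_expansion f c)}"

definition hydro_coeff :: "(complex \<Rightarrow> complex) \<Rightarrow> real" where
  "hydro_coeff f = (THE c. hydrodynamic_expansion f c)"

lemma hydrodynamic_expansion_unique:
  assumes "hydrodynamic_expansion f c" "hydrodynamic_expansion f d"
  shows "c = d"
proof -
  define F where "F = nontangential_at_infinity 1"
  from assms obtain g h where
    g: "\<forall>z\<in>upper_half. f z = z - of_real c / z + g z" "((\<lambda>z. z * g z) \<longlongrightarrow> 0) F" and
    h: "\<forall>z\<in>upper_half. f z = z - of_real d / z + h z" "((\<lambda>z. z * h z) \<longlongrightarrow> 0) F"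
    unfolding hydrodynamic_expansion_def F_def by (meson zero_less_one)
  have ray: "filterlim (\<lambda>n. of_nat n * \<i>) F sequentially"
    unfolding F_def nontangential_at_infinity_def
  proof (rule filterlim_inf[THEN iffD2, OF conjI])
    have "filterlim (\<lambda>n. norm (of_nat n * \<i>)) at_top sequentially"
      by (simp add: norm_mult filterlim_real_sequentially)
    then show "filterlim (\<lambda>n. of_nat n * \<i>) at_infinity sequentially"
      by (simp add: filterlim_at_infinity_conv_norm_at_top)
    have arg: "Arg (of_nat n * \<i>) = pi / 2" if "n > 0" for n
      using that Arg_times_of_real[of "real n" \<i>] by simp
    have "1 < Arg (of_nat n * \<i>) \<and> Arg (of_nat n * \<i>) < pi - 1" if "n > 0" for n
      unfolding arg[OF that] using pi_gt3 by linarith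
    then show "filterlim (\<lambda>n. of_nat n * \<i>)
        (principal {z. 1 < Arg z \<and> Arg z < pi - 1}) sequentially"
      unfolding filterlim_principal
      by (intro eventually_mono[OF eventually_gt_at_top[of 0]]) simp
  qed
  have "((\<lambda>n. (of_nat n * \<i>) * g (of_nat n * \<i>) - (of_nat n * \<i>) * h (of_nat n * \<i>)) \<longlongrightarrow> 0 - 0)
      sequentially"
    by (intro tendsto_diff filterlim_compose[OF g(2) ray] filterlim_compose[OF h(2) ray])
  moreover have "\<forall>\<^sub>F n in sequentially.
      (of_nat n * \<i>) * g (of_nat n * \<i>) - (of_nat n * \<i>) * h (of_nat n * \<i>) = of_real (c - d)"
  proof (rule eventually_mono[OF eventually_gt_at_top[of 0]])
    fix n :: nat assume "n > 0"
    define z where "z = of_nat n * \<i>"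
    have z: "z \<in> upper_half" "z \<noteq> 0" using \<open>n > 0\<close> by (auto simp: z_def)
    have "z - of_real c / z + g z = z - of_real d / z + h z"
      using g(1) h(1) z(1) by metis
    then have "z * g z - z * h z = of_real (c - d)"
      using z(2) by (simp add: field_simps)
    then show "(of_nat n * \<i>) * g (of_nat n * \<i>) - (of_nat n * \<i>) * h (of_nat n * \<i>) = of_real (c - d)"
      by (simp add: z_def)
  qed
  ultimately have "((\<lambda>n::nat. complex_of_real (c - d)) \<longlongrightarrow> 0) sequentially"
    by (simp add: tendsto_cong)
  then show "c = d" by (simp add: tendsto_const_iff)
qed

lemma hydro_coeff_eq: "hydrodynamic_expansion f c \<Longrightarrow> hydro_coeff f = c"
  unfolding hydro_coeff_def using hydrodynamic_expansion_unique by blast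

definition K_half :: "real \<Rightarrow> (complex \<Rightarrow> complex) set" where
  "K_half c =
     {H. \<exists>\<Phi>. continuous_semigroup upper_half \<Phi> \<and> is_generator upper_half \<Phi> H \<and>
             (\<forall>t\<ge>0. \<Phi> t \<in> hydrodynamic_maps) \<and> hydro_coeff (\<Phi> 1) \<le> c}"

definition cayley :: "complex \<Rightarrow> complex" where
  "cayley z = (z - \<i>) / (z + \<i>)"

lemma bij_betw_cayley: "bij_betw cayley upper_half unit_disc"
proof (rule bij_betw_byWitness[where f' = "\<lambda>w. \<i> * (1 + w) / (1 - w)"])
  have nz: "z + \<i> \<noteq> 0" if "Im z > 0" for z
    using that by (auto simp: complex_eq_iff)
  show "\<forall>z\<in>upper_half. \<i> * (1 + cayley z) / (1 - cayley z) = z"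
  proof
    fix z assume "z \<in> upper_half"
    then have z: "z + \<i> \<noteq> 0" using nz by simp
    have "1 + cayley z = 2 * z / (z + \<i>)" "1 - cayley z = 2 * \<i> / (z + \<i>)"
      using z by (simp_all add: cayley_def field_simps)
    then show "\<i> * (1 + cayley z) / (1 - cayley z) = z"
      using z by simp
  qed
  show "\<forall>w\<in>unit_disc. cayley (\<i> * (1 + w) / (1 - w)) = w"
  proof
    fix w :: complex assume "w \<in> unit_disc"
    then have w: "1 - w \<noteq> 0" by auto
    have "\<i> * (1 + w) / (1 - w) - \<i> = 2 * \<i> * w / (1 - w)"
      "\<i> * (1 + w) / (1 - w) + \<i> = 2 * \<i> / (1 - w)"
      using w by (simp_all add: field_simps)
    then show "cayley (\<i> * (1 + w) / (1 - w)) = w"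
      using w by (simp add: cayley_def)
  qed
  show "cayley ` upper_half \<subseteq> unit_disc"
  proof clarify
    fix z assume z: "Im z > 0"
    have "(norm (z - \<i>))\<^sup>2 < (norm (z + \<i>))\<^sup>2"
      using z unfolding cmod_power2 by (simp add: power2_eq_square algebra_simps)
    then have "norm (z - \<i>) < norm (z + \<i>)"
      using power_less_imp_less_base by fastforce
    then show "norm (cayley z) < 1"
      using nz[OF z] by (simp add: cayley_def norm_divide)
  qed
  show "(\<lambda>w. \<i> * (1 + w) / (1 - w)) ` unit_disc \<subseteq> upper_half"
  proof clarify
    fix w :: complex assume w: "norm w < 1"
    then have "w \<noteq> 1" by auto
    then have pos: "(1 - Re w)\<^sup>2 + (Im w)\<^sup>2 > 0"
      by (auto simp: complex_eq_iff sum_power2_gt_zero_iff)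
    have "(Re w)\<^sup>2 + (Im w)\<^sup>2 < 1"
      using w by (metis cmod_power2 norm_ge_zero one_power2 power_strict_mono zero_less_numeral)
    moreover have "Im (\<i> * (1 + w) / (1 - w))
        = (1 - (Re w)\<^sup>2 - (Im w)\<^sup>2) / ((1 - Re w)\<^sup>2 + (Im w)\<^sup>2)"
      by (simp add: Im_divide power2_eq_square algebra_simps)
    ultimately show "Im (\<i> * (1 + w) / (1 - w)) > 0"
      using pos by simp
  qed
qed

definition K_disc :: "real \<Rightarrow> (complex \<Rightarrow> complex) set" where
  "K_disc c =
     {G. \<exists>H\<in>K_half c. \<forall>w\<in>unit_disc.
           G w = deriv cayley (inv_into upper_half cayley w) * H (inv_into upper_half cayley w)}"

definition hyp_length_disc :: "complex \<Rightarrow> complex \<Rightarrow> real" where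
  "hyp_length_disc z v = 2 * norm v / (1 - (norm z)\<^sup>2)"

definition hyp_length_half :: "complex \<Rightarrow> complex \<Rightarrow> real" where
  "hyp_length_half z v = norm v / Im z"

definition horo_radius_disc :: "complex \<Rightarrow> real" where
  "horo_radius_disc z = (norm (1 - z))\<^sup>2 / (1 - (norm z)\<^sup>2)"

definition horo_radius_half :: "complex \<Rightarrow> real" where
  "horo_radius_half z = 1 / Im z"

end

theory Submission
  imports Defs
begin

text \<open>On the half-plane the hyperbolic estimate reads \<open>|H(z)| \<le> c / Im z\<close>, and everything
  rests on the Schwarz--Pick inequality with one of the two points moved to \<open>\<infinity>\<close> along the imaginary axis.

  If the semigroup is hydrodynamic, this limit first shows that \<open>f = \<Phi>\<^sub>t\<close> satisfies
  \<open>Im f(z) \<ge> Im z\<close> and then, applied to \<open>g(z) = f(z) - z\<close>, that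
  \<open>|g|\<^sup>2 Im z \<le> l(f) Im g\<close>, so that \<open>|f(z) - z| \<le> l(f) / Im z\<close>.
  Since \<open>l\<close> is additive along the semigroup, dividing by \<open>t = 1/n\<close> gives the estimate for \<open>H\<close>.

  Conversely, the limit in the infinitesimal Schwarz--Pick inequality yields \<open>Im H \<ge> 0\<close>.
  Hence \<open>Im \<Phi>\<^sub>t\<close> increases in \<open>t\<close>, and integrating \<open>H\<close> along the trajectory gives
  \<open>|\<Phi>\<^sub>t(z) - z| \<le> c t / Im z\<close>. For \<open>g(z) = \<Phi>\<^sub>t(z) - z\<close> the map \<open>-1/g\<close>
  has an angular derivative \<open>a \<ge> 1/(c t)\<close> at \<open>\<infinity>\<close> by the Julia--Wolff--Caratheodory theorem, which is the
  hydrodynamic expansion of \<open>\<Phi>\<^sub>t\<close> with \<open>l(\<Phi>\<^sub>t) = 1/a \<le> c t\<close>.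
  The statement on the disc follows by conjugation with the Cayley map, a hyperbolic isometry.\<close>

section \<open>Schwarz--Pick and angular derivatives on the half-plane\<close>

text \<open>Translates between the pseudo-hyperbolic quotient |z - w| / |z - cnj w| and the
  invariant |z - w|^2 / (Im z Im w), and so links the forms of Schwarz--Pick below.\<close>

lemma norm_diff_cnj_squared:
  "(norm (z - cnj w))\<^sup>2 = (norm (z - w))\<^sup>2 + 4 * Im z * Im w"
  unfolding cmod_power2 by (simp add: power2_eq_square algebra_simps)

lemma diff_cnj_nonzero:
  assumes "Im z > 0" "Im w \<ge> 0"
  shows "z - cnj w \<noteq> 0"
  using assms by (auto simp: complex_eq_iff)

text \<open>This is the Schwarz lemma for \<open>g\<close> conjugated with the Moebius maps onto the
  disc that send \<open>w\<close> and \<open>g w\<close> to 0.\<close>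

lemma schwarz_pick_half_plane_strict:
  assumes hol: "g holomorphic_on upper_half"
    and pos: "\<And>z. Im z > 0 \<Longrightarrow> Im (g z) > 0"
    and z: "Im z > 0" and w: "Im w > 0"
  shows "norm (g z - g w) * norm (z - cnj w) \<le> norm (z - w) * norm (g z - cnj (g w))"
proof -
  \<comment> \<open>\<open>M\<close> inverts z -> (z - w) / (z - cnj w), hence
    \<open>M 0 = w\<close>.\<close>
  define M where "M \<zeta> = (w - cnj w * \<zeta>) / (1 - \<zeta>)" for \<zeta>
  define h where "h \<zeta> = (g (M \<zeta>) - g w) / (g (M \<zeta>) - cnj (g w))" for \<zeta>
  have ImM: "Im (M \<zeta>) > 0" if "norm \<zeta> < 1" for \<zeta>
  proof -
    have ne: "1 - \<zeta> \<noteq> 0" using that by auto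
    have "(Re \<zeta>)\<^sup>2 + (Im \<zeta>)\<^sup>2 < 1"
      using that by (metis cmod_power2 norm_ge_zero one_power2 power_strict_mono zero_less_numeral)
    moreover have "(Re (1 - \<zeta>))\<^sup>2 + (Im (1 - \<zeta>))\<^sup>2 > 0"
      using ne unfolding complex_neq_0 .
    moreover have "Im (M \<zeta>) = Im w * (1 - ((Re \<zeta>)\<^sup>2 + (Im \<zeta>)\<^sup>2)) / ((Re (1 - \<zeta>))\<^sup>2 + (Im (1 - \<zeta>))\<^sup>2)"
      unfolding M_def Im_divide by (simp add: power2_eq_square algebra_simps)
    ultimately show ?thesis using w by simp
  qed
  have holM: "M holomorphic_on ball 0 1"
    unfolding M_def by (intro holomorphic_intros) auto
  have "(g \<circ> M) holomorphic_on ball 0 1"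
    by (rule holomorphic_on_compose_gen[OF holM hol]) (auto simp: ImM)
  then have holgM: "(\<lambda>\<zeta>. g (M \<zeta>)) holomorphic_on ball 0 1"
    by (simp add: o_def)
  have den: "g (M \<zeta>) - cnj (g w) \<noteq> 0" if "norm \<zeta> < 1" for \<zeta>
    using diff_cnj_nonzero pos ImM[OF that] w by (simp add: less_imp_le)
  have 1: "h holomorphic_on ball 0 1"
    unfolding h_def using den by (intro holomorphic_intros holgM) auto
  have 2: "h 0 = 0" by (simp add: h_def M_def)
  have 3: "norm (h \<zeta>) < 1" if "norm \<zeta> < 1" for \<zeta>
  proof -
    have "(norm (g (M \<zeta>) - g w))\<^sup>2 < (norm (g (M \<zeta>) - cnj (g w)))\<^sup>2"
      unfolding norm_diff_cnj_squared using pos ImM[OF that] w by simp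
    then have "norm (g (M \<zeta>) - g w) < norm (g (M \<zeta>) - cnj (g w))"
      using power_less_imp_less_base norm_ge_zero by blast
    then show ?thesis using den[OF that] by (simp add: h_def norm_divide)
  qed
  define \<zeta> where "\<zeta> = (z - w) / (z - cnj w)"
  have zw: "z - cnj w \<noteq> 0" using diff_cnj_nonzero z w by simp
  have "(norm (z - w))\<^sup>2 < (norm (z - cnj w))\<^sup>2"
    unfolding norm_diff_cnj_squared using z w by simp
  then have "norm (z - w) < norm (z - cnj w)"
    using power_less_imp_less_base norm_ge_zero by blast
  then have nz: "norm \<zeta> < 1" using zw by (simp add: \<zeta>_def norm_divide)
  have "w - cnj w \<noteq> 0" using w by (auto simp: complex_eq_iff)
  moreover have "1 - \<zeta> = (w - cnj w) / (z - cnj w)"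
    "w - cnj w * \<zeta> = z * (w - cnj w) / (z - cnj w)"
    using zw by (simp_all add: \<zeta>_def field_simps)
  ultimately have "M \<zeta> = z" using zw by (simp add: M_def)
  then have "norm (g z - g w) / norm (g z - cnj (g w)) \<le> norm (z - w) / norm (z - cnj w)"
    using Schwarz_Lemma(1)[OF 1 2 3 nz] by (simp add: h_def \<zeta>_def norm_divide)
  then show ?thesis
    using zw den[OF nz] \<open>M \<zeta> = z\<close> by (simp add: field_simps)
qed

text \<open>Apply the strict version to \<open>g + \<i> * e\<close> and let \<open>e\<close> tend to
  0; after squaring, a common term cancels. The form without division keeps its meaning where
  \<open>Im (g z) = 0\<close>, which can happen for the displacement g(z) = f(z) - z.\<close>

lemma schwarz_pick_half_plane:
  assumes hol: "g holomorphic_on upper_half"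
    and nonneg: "\<And>z. Im z > 0 \<Longrightarrow> Im (g z) \<ge> 0"
    and z: "Im z > 0" and w: "Im w > 0"
  shows "Im z * Im w * (norm (g z - g w))\<^sup>2 \<le> Im (g z) * Im (g w) * (norm (z - w))\<^sup>2"
proof -
  have *: "Im z * Im w * (norm (g z - g w))\<^sup>2 \<le> (Im (g z) + e) * (Im (g w) + e) * (norm (z - w))\<^sup>2"
    if "e > 0" for e
  proof -
    let ?g = "\<lambda>z. g z + \<i> * of_real e"
    have "norm (?g z - ?g w) * norm (z - cnj w) \<le> norm (z - w) * norm (?g z - cnj (?g w))"
      using that by (intro schwarz_pick_half_plane_strict z w holomorphic_intros hol)
        (simp add: nonneg add_nonneg_pos)
    then have "(norm (?g z - ?g w) * norm (z - cnj w))\<^sup>2 \<le> (norm (z - w) * norm (?g z - cnj (?g w)))\<^sup>2"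
      by (intro power_mono) auto
    then show ?thesis
      unfolding power_mult_distrib norm_diff_cnj_squared by (simp add: algebra_simps)
  qed
  have "((\<lambda>e. (Im (g z) + e) * (Im (g w) + e) * (norm (z - w))\<^sup>2) \<longlongrightarrow>
      (Im (g z) + 0) * (Im (g w) + 0) * (norm (z - w))\<^sup>2) (at_right 0)"
    by (intro tendsto_intros)
  then show ?thesis
    using * by (intro tendsto_lowerbound[of "\<lambda>e. (Im (g z) + e) * (Im (g w) + e) * (norm (z - w))\<^sup>2" _ "at_right 0"])
      (auto simp: eventually_at_right_less intro: eventually_mono[OF eventually_at_right_less])
qed

text \<open>Both sides grow by the same \<open>4 * Im z * Im w * Im (g z) * Im (g w)\<close>. In
  this form |g z - cnj (g w)| dominates \<open>Im (g z)\<close>, which lets one factor cancel in the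
  angular limit.\<close>

lemma schwarz_pick_half_plane_cnj:
  assumes "g holomorphic_on upper_half" "\<And>z. Im z > 0 \<Longrightarrow> Im (g z) \<ge> 0" "Im z > 0" "Im w > 0"
  shows "Im z * Im w * (norm (g z - cnj (g w)))\<^sup>2 \<le> Im (g z) * Im (g w) * (norm (z - cnj w))\<^sup>2"
  using schwarz_pick_half_plane[OF assms] unfolding norm_diff_cnj_squared by (simp add: algebra_simps)

section \<open>Angular limits at infinity\<close>

lemma sector_imp_Im_bounds:
  assumes "\<delta> < Arg z" "Arg z < pi - \<delta>" "0 < \<delta>" "z \<noteq> 0"
  shows "sin \<delta> * norm z \<le> Im z" "0 < Im z" "0 < sin \<delta>"
proof -
  have *: "Im z = norm z * sin (Arg z)"
    using Arg_eq[OF assms(4)] by (metis Im_rcis rcis_cmod_Arg)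
  have "sin \<delta> \<le> sin (Arg z)"
  proof (cases "Arg z \<le> pi / 2")
    case True
    then show ?thesis using assms by (intro sin_monotone_2pi_le) auto
  next
    case False
    have "sin \<delta> \<le> sin (pi - Arg z)" using assms False by (intro sin_monotone_2pi_le) auto
    then show ?thesis by simp
  qed
  then show "sin \<delta> * norm z \<le> Im z" using * by (simp add: mult.commute mult_left_mono)
  show "0 < Im z" using assms Arg_lt_pi[of z] by auto
  show "0 < sin \<delta>" using assms by (intro sin_gt_zero) auto
qed

text \<open>Membership in the sector forces \<delta> < pi / 2 and hence
  \<open>0 < sin \<delta>\<close>; for larger \<delta> the sector is empty and the filter is
  trivial.\<close>

lemma eventually_sector:
  assumes "\<delta> > 0"
  shows "\<forall>\<^sub>F z in nontangential_at_infinity \<delta>. sin \<delta> * norm z \<le> Im z \<and> 0 < Im z \<and> 0 < sin \<delta> \<and> R \<le> norm z"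
proof -
  have "\<forall>\<^sub>F z::complex in at_infinity. norm z \<ge> max R 1"
    unfolding eventually_at_infinity by blast
  then show ?thesis
    unfolding nontangential_at_infinity_def eventually_inf_principal
  proof eventually_elim
    case (elim z)
    have "z \<noteq> 0" using elim by auto
    then show ?case using sector_imp_Im_bounds[of \<delta> z] assms elim by auto
  qed
qed

lemma nontangential_le_at_infinity: "nontangential_at_infinity \<delta> \<le> at_infinity"
  unfolding nontangential_at_infinity_def by simp

text \<open>The slope-zero case of Julia--Wolff--Caratheodory. Schwarz--Pick is anchored at a point
  \<open>w\<close> where the slope of \<open>Im F\<close> is tiny; in a sector \<open>Im z\<close>
  is comparable to \<open>norm z\<close>, so the estimate becomes \<open>F z = o(z)\<close>.\<close>

lemma angular_limit_zero:
  assumes hol: "F holomorphic_on upper_half"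
    and nonneg: "\<And>z. Im z > 0 \<Longrightarrow> Im (F z) \<ge> 0"
    and inf: "\<And>e. e > 0 \<Longrightarrow> \<exists>w. Im w > 0 \<and> Im (F w) \<le> e * Im w"
    and \<delta>: "\<delta> > 0"
  shows "((\<lambda>z. F z / z) \<longlongrightarrow> 0) (nontangential_at_infinity \<delta>)"
proof (cases "sin \<delta> > 0")
  case False
  have "\<forall>\<^sub>F z in nontangential_at_infinity \<delta>. False"
    by (rule eventually_mono[OF eventually_sector[OF \<delta>, of 0]]) (use False in auto)
  then show ?thesis by (simp add: eventually_False)
next
  case True
  show ?thesis
  proof (rule tendstoI)
    fix e :: real assume "e > 0"
    \<comment> \<open>The bound \<open>norm (z - cnj w) \<le> 2 * norm z\<close> costs a factor 4,
      so 12 leaves \<open>X \<le> e * norm z / 3\<close>.\<close>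
    define e' where "e' = e * sin \<delta> / 12"
    have "e' > 0" using \<open>e > 0\<close> True by (simp add: e'_def)
    obtain w where w: "Im w > 0" "Im (F w) \<le> e' * Im w" using inf[OF \<open>e' > 0\<close>] by blast
    \<comment> \<open>The first entry gives \<open>norm (z - cnj w) \<le> 2 * norm z\<close>, the
      second makes \<open>norm (F w)\<close> smaller than \<open>e * norm z / 4\<close>.\<close>
    define R where "R = max (norm w) (4 * norm (F w) / e + 1)"
    have "\<forall>\<^sub>F z in nontangential_at_infinity \<delta>. sin \<delta> * norm z \<le> Im z \<and> 0 < Im z \<and> 0 < sin \<delta> \<and> R \<le> norm z"
      by (rule eventually_sector[OF \<delta>])
    then show "\<forall>\<^sub>F z in nontangential_at_infinity \<delta>. dist (F z / z) 0 < e"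
    proof eventually_elim
      case (elim z)
      then have z: "Im z > 0" by simp
      have R: "R \<le> norm z" using elim by simp
      have nz: "norm z > 0" using z by auto
      define X where "X = norm (F z - cnj (F w))"
      have ImX: "Im (F z) \<le> X"
        using abs_Im_le_cmod[of "F z - cnj (F w)"] nonneg[OF w(1)] by (simp add: X_def)
      have "Im z * Im w * X\<^sup>2 \<le> Im (F z) * Im (F w) * (norm (z - cnj w))\<^sup>2"
        unfolding X_def by (rule schwarz_pick_half_plane_cnj[OF hol nonneg z w(1)])
      also have "\<dots> \<le> X * (e' * Im w) * (norm (z - cnj w))\<^sup>2"
        using ImX w nonneg[OF z] nonneg[OF w(1)] by (intro mult_right_mono mult_mono) (auto simp: X_def)
      finally have "Im w * (X * (Im z * X)) \<le> Im w * (X * (e' * (norm (z - cnj w))\<^sup>2))"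
        by (simp add: power2_eq_square algebra_simps)
      then have "X * (Im z * X) \<le> X * (e' * (norm (z - cnj w))\<^sup>2)" using w(1) by simp
      then have 1: "Im z * X \<le> e' * (norm (z - cnj w))\<^sup>2"
        using \<open>e' > 0\<close> by (cases "X = 0") (auto simp: X_def)
      have "norm (z - cnj w) \<le> norm z + norm w"
        using norm_triangle_ineq4[of z "cnj w"] by simp
      also have "\<dots> \<le> 2 * norm z" using R by (simp add: R_def)
      finally have "(norm (z - cnj w))\<^sup>2 \<le> (2 * norm z)\<^sup>2" by (intro power_mono) auto
      then have "e' * (norm (z - cnj w))\<^sup>2 \<le> e' * (2 * norm z)\<^sup>2" using \<open>e' > 0\<close> by simp
      moreover have "sin \<delta> * norm z * X \<le> Im z * X"
        using elim by (intro mult_right_mono) (auto simp: X_def)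
      ultimately have "sin \<delta> * norm z * X \<le> e' * (2 * norm z)\<^sup>2" using 1 by linarith
      also have "\<dots> = sin \<delta> * norm z * (e * norm z / 3)"
        by (simp add: e'_def power2_eq_square)
      finally have X: "X \<le> e * norm z / 3" using True nz by (simp add: mult.assoc)
      have "norm (F z) \<le> X + norm (F w)"
        using norm_triangle_ineq[of "F z - cnj (F w)" "cnj (F w)"] by (simp add: X_def)
      moreover have "norm (F w) < e * norm z / 4"
      proof -
        have "4 * norm (F w) / e < norm z" using R by (simp add: R_def)
        then show ?thesis using \<open>e > 0\<close> by (simp add: field_simps)
      qed
      moreover have "e * norm z > 0" using \<open>e > 0\<close> nz by simp
      ultimately have "norm (F z) < e * norm z" using X by linarith
      then show ?case using nz by (simp add: norm_divide divide_simps)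
    qed
  qed
qed

text \<open>The number \<open>a\<close> is the infimum of \<open>Im (F z) / Im z\<close>.
  Subtracting \<open>a * z\<close> keeps the imaginary part nonnegative and brings the infimal slope
  to 0, the case already settled.\<close>

lemma angular_derivative_at_infinity:
  assumes hol: "F holomorphic_on upper_half"
    and nonneg: "\<And>z. Im z > 0 \<Longrightarrow> Im (F z) \<ge> 0"
  shows "\<exists>a\<ge>0. (\<forall>z. Im z > 0 \<longrightarrow> a * Im z \<le> Im (F z)) \<and>
    (\<forall>\<delta>>0. ((\<lambda>z. F z / z) \<longlongrightarrow> of_real a) (nontangential_at_infinity \<delta>))"
proof (intro exI conjI allI impI)
  define S where "S = (\<lambda>z. Im (F z) / Im z) ` upper_half"
  define a where "a = Inf S"
  have ne: "S \<noteq> {}" unfolding S_def by (auto intro: exI[of _ \<i>])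
  have lb: "\<And>x. x \<in> S \<Longrightarrow> 0 \<le> x" using nonneg by (auto simp: S_def)
  have bdd: "bdd_below S" using lb by (meson bdd_belowI)
  show "a \<ge> 0" unfolding a_def using ne lb by (rule cInf_greatest)
  show a_le: "a * Im z \<le> Im (F z)" if "Im z > 0" for z
  proof -
    have "a \<le> Im (F z) / Im z" unfolding a_def
      by (rule cInf_lower) (use that bdd in \<open>auto simp: S_def\<close>)
    then show ?thesis using that by (simp add: field_simps)
  qed
  show "((\<lambda>z. F z / z) \<longlongrightarrow> of_real a) (nontangential_at_infinity \<delta>)" if \<delta>: "\<delta> > 0" for \<delta>
  proof -
    have "((\<lambda>z. (F z - of_real a * z) / z) \<longlongrightarrow> 0) (nontangential_at_infinity \<delta>)"
    proof (rule angular_limit_zero[OF _ _ _ \<delta>])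
      show "(\<lambda>z. F z - of_real a * z) holomorphic_on upper_half"
        by (intro holomorphic_intros hol)
      show "\<And>z. 0 < Im z \<Longrightarrow> 0 \<le> Im (F z - of_real a * z)" using a_le by simp
      fix e :: real assume "e > 0"
      then have "Inf S < a + e" by (simp add: a_def)
      then obtain x where "x \<in> S" "x < a + e" using cInf_lessD[OF ne] by blast
      then obtain w where w: "Im w > 0" "Im (F w) / Im w < a + e" by (auto simp: S_def)
      then have "Im (F w - of_real a * w) \<le> e * Im w" by (simp add: field_simps)
      then show "\<exists>w. 0 < Im w \<and> Im (F w - of_real a * w) \<le> e * Im w" using w(1) by blast
    qed
    then have "((\<lambda>z. (F z - of_real a * z) / z + of_real a) \<longlongrightarrow> 0 + of_real a) (nontangential_at_infinity \<delta>)"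
      by (intro tendsto_add tendsto_const)
    moreover have "\<forall>\<^sub>F z in nontangential_at_infinity \<delta>. (F z - of_real a * z) / z + of_real a = F z / z"
      using eventually_sector[OF \<delta>, of 1]
    proof eventually_elim
      case (elim z)
      then have "z \<noteq> 0" by auto
      then show ?case by (simp add: field_simps)
    qed
    ultimately show ?thesis
      using Lim_transform_eventually by fastforce
  qed
qed

section \<open>Hydrodynamic maps\<close>

text \<open>Allows angular limits to be taken along curves that leave the imaginary axis, as in
  f(h(iy)). Dividing by \<open>y > 0\<close> does not change the argument, which tends to pi / 2;
  the sector with \<delta> = 1 contains this direction because 1 < pi / 2.\<close>

lemma filterlim_nontangential_if_asymptotic_to_ray:
  assumes lim: "((\<lambda>y. h y / of_real y) \<longlongrightarrow> \<i>) at_top"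
  shows "filterlim h (nontangential_at_infinity 1) at_top"
  unfolding nontangential_at_infinity_def
proof (rule filterlim_inf[THEN iffD2, OF conjI])
  have pos: "\<forall>\<^sub>F y in at_top. (y::real) > 0" by (rule eventually_gt_at_top)
  have "((\<lambda>y. norm (h y / of_real y)) \<longlongrightarrow> norm \<i>) at_top"
    by (intro tendsto_norm lim)
  then have "((\<lambda>y. norm (h y / of_real y)) \<longlongrightarrow> 1) at_top" by simp
  from filterlim_tendsto_pos_mult_at_top[OF this _ filterlim_ident]
  have "filterlim (\<lambda>y. norm (h y / of_real y) * y) at_top at_top" by simp
  then have "filterlim (\<lambda>y. norm (h y)) at_top at_top"
    by (rule filterlim_cong[THEN iffD1, rotated -1, OF _ refl refl])
      (use pos in \<open>eventually_elim, simp add: norm_divide\<close>)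
  then show "filterlim h at_infinity at_top"
    by (simp add: filterlim_at_infinity_conv_norm_at_top)
  have "((\<lambda>y. Arg (h y / of_real y)) \<longlongrightarrow> Arg \<i>) at_top"
    by (rule tendsto_Arg[OF lim]) (auto simp: complex_nonpos_Reals_iff)
  then have lim': "((\<lambda>y. Arg (h y / of_real y)) \<longlongrightarrow> pi / 2) at_top" by simp
  have "\<forall>\<^sub>F y in at_top. 1 < Arg (h y / of_real y)"
    "\<forall>\<^sub>F y in at_top. Arg (h y / of_real y) < pi - 1"
    using pi_gt3 by (auto intro: order_tendstoD[OF lim'])
  with pos have "\<forall>\<^sub>F y in at_top. 1 < Arg (h y) \<and> Arg (h y) < pi - 1"
    by eventually_elim simp
  then show "filterlim h (principal {z. 1 < Arg z \<and> Arg z < pi - 1}) at_top"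
    by (simp add: filterlim_principal)
qed

lemma filterlim_imaginary_ray:
  "filterlim (\<lambda>y. \<i> * of_real y) (nontangential_at_infinity 1) at_top"
proof (rule filterlim_nontangential_if_asymptotic_to_ray)
  show "((\<lambda>y. \<i> * of_real y / of_real y) \<longlongrightarrow> \<i>) at_top"
    by (rule tendsto_eventually, rule eventually_mono[OF eventually_gt_at_top[of 0]]) simp
qed

text \<open>The remainder \<gamma> is determined by \<open>f\<close> and \<open>c\<close>, so the
  expansion amounts to a single angular limit.\<close>

lemma hydrodynamic_expansion_iff:
  "hydrodynamic_expansion f c \<longleftrightarrow>
     c \<ge> 0 \<and> (\<forall>\<delta>>0. ((\<lambda>z. z * (f z - z)) \<longlongrightarrow> - of_real c) (nontangential_at_infinity \<delta>))"
proof -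
  have ev: "\<forall>\<^sub>F z in nontangential_at_infinity \<delta>. z \<in> upper_half \<and> z \<noteq> 0" if "\<delta> > 0" for \<delta>
    by (rule eventually_mono[OF eventually_sector[OF that, of 1]]) auto
  show ?thesis
  proof safe
    assume "hydrodynamic_expansion f c"
    then obtain \<gamma> where "c \<ge> 0" and \<gamma>: "\<forall>z\<in>upper_half. f z = z - of_real c / z + \<gamma> z"
      "\<And>\<delta>. \<delta> > 0 \<Longrightarrow> ((\<lambda>z. z * \<gamma> z) \<longlongrightarrow> 0) (nontangential_at_infinity \<delta>)"
      unfolding hydrodynamic_expansion_def by blast
    show "c \<ge> 0" by fact
    fix \<delta> :: real assume "\<delta> > 0"
    have "((\<lambda>z. - of_real c + z * \<gamma> z) \<longlongrightarrow> - of_real c + 0) (nontangential_at_infinity \<delta>)"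
      by (intro tendsto_intros \<gamma> \<open>\<delta> > 0\<close>)
    moreover have "\<forall>\<^sub>F z in nontangential_at_infinity \<delta>. - of_real c + z * \<gamma> z = z * (f z - z)"
      using ev[OF \<open>\<delta> > 0\<close>]
    proof eventually_elim
      case (elim z)
      then have "f z - z = \<gamma> z - of_real c / z" using \<gamma>(1) by auto
      then show ?case using elim by (simp add: field_simps)
    qed
    ultimately show "((\<lambda>z. z * (f z - z)) \<longlongrightarrow> - of_real c) (nontangential_at_infinity \<delta>)"
      using Lim_transform_eventually by fastforce
  next
    assume "c \<ge> 0" and *: "\<forall>\<delta>>0. ((\<lambda>z. z * (f z - z)) \<longlongrightarrow> - of_real c) (nontangential_at_infinity \<delta>)"
    define \<gamma> where "\<gamma> z = f z - z + of_real c / z" for z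
    have "((\<lambda>z. z * \<gamma> z) \<longlongrightarrow> 0) (nontangential_at_infinity \<delta>)" if "\<delta> > 0" for \<delta>
    proof -
      have "((\<lambda>z. z * (f z - z) + of_real c) \<longlongrightarrow> - of_real c + of_real c) (nontangential_at_infinity \<delta>)"
        using * that by (intro tendsto_intros) auto
      moreover have "\<forall>\<^sub>F z in nontangential_at_infinity \<delta>. z * (f z - z) + of_real c = z * \<gamma> z"
        using ev[OF that] by eventually_elim (simp add: \<gamma>_def field_simps)
      ultimately show ?thesis
        using Lim_transform_eventually by fastforce
    qed
    moreover have "\<forall>z\<in>upper_half. f z = z - of_real c / z + \<gamma> z" by (simp add: \<gamma>_def)
    ultimately show "hydrodynamic_expansion f c"
      unfolding hydrodynamic_expansion_def using \<open>c \<ge> 0\<close> by blast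
  qed
qed

lemma hydrodynamic_expansion_ray:
  assumes "hydrodynamic_expansion f c"
  shows "((\<lambda>y. (\<i> * of_real y) * (f (\<i> * of_real y) - \<i> * of_real y)) \<longlongrightarrow> - of_real c) at_top"
    and "((\<lambda>y. f (\<i> * of_real y) - \<i> * of_real y) \<longlongrightarrow> 0) at_top"
    and "((\<lambda>y. f (\<i> * of_real y) / of_real y) \<longlongrightarrow> \<i>) at_top"
proof -
  let ?w = "\<lambda>y::real. \<i> * complex_of_real y"
  let ?g = "\<lambda>y. f (?w y) - ?w y"
  have lim: "((\<lambda>z. z * (f z - z)) \<longlongrightarrow> - of_real c) (nontangential_at_infinity 1)"
    using assms hydrodynamic_expansion_iff by auto
  show 1: "((\<lambda>y. ?w y * ?g y) \<longlongrightarrow> - of_real c) at_top"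
    by (rule filterlim_compose[OF lim filterlim_imaginary_ray])
  have inv: "((\<lambda>y. inverse (?w y)) \<longlongrightarrow> 0) at_top"
    by (rule filterlim_compose[OF tendsto_inverse_0])
      (rule filterlim_mono[OF filterlim_imaginary_ray nontangential_le_at_infinity order_refl])
  have pos: "\<forall>\<^sub>F y in at_top. (y::real) > 0" by (rule eventually_gt_at_top)
  have "((\<lambda>y. inverse (?w y) * (?w y * ?g y)) \<longlongrightarrow> 0 * - of_real c) at_top"
    by (intro tendsto_mult inv 1)
  moreover have "\<forall>\<^sub>F y in at_top. inverse (?w y) * (?w y * ?g y) = ?g y"
    using pos by eventually_elim (simp add: field_simps)
  ultimately show 2: "(?g \<longlongrightarrow> 0) at_top"
    using Lim_transform_eventually by fastforce
  have "((\<lambda>y. \<i> + \<i> * inverse (?w y) * ?g y) \<longlongrightarrow> \<i> + \<i> * 0 * 0) at_top"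
    by (intro tendsto_intros inv 2)
  moreover have "\<forall>\<^sub>F y in at_top. \<i> + \<i> * inverse (?w y) * ?g y = f (?w y) / of_real y"
    using pos by eventually_elim (simp add: field_simps)
  ultimately show "((\<lambda>y. f (?w y) / of_real y) \<longlongrightarrow> \<i>) at_top"
    using Lim_transform_eventually by fastforce
qed

text \<open>The expansion forces the angular derivative of \<open>f\<close> at infinity to be 1, and
  that derivative is a lower bound for \<open>Im (f z) / Im z\<close>.\<close>

lemma hydrodynamic_Im_increasing:
  assumes hol: "f holomorphic_on upper_half" and maps: "f ` upper_half \<subseteq> upper_half"
    and exp: "hydrodynamic_expansion f c" and z: "Im z > 0"
  shows "Im z \<le> Im (f z)"
proof -
  have "Im (f z) \<ge> 0" if "Im z > 0" for z using maps that by (auto simp: image_subset_iff less_imp_le)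
  from angular_derivative_at_infinity[OF hol this]
  obtain a where a: "\<forall>z. Im z > 0 \<longrightarrow> a * Im z \<le> Im (f z)"
    "\<forall>\<delta>>0. ((\<lambda>z. f z / z) \<longlongrightarrow> of_real a) (nontangential_at_infinity \<delta>)"
    by blast
  have "((\<lambda>y. \<i> * (f (\<i> * of_real y) / (\<i> * of_real y))) \<longlongrightarrow> \<i> * of_real a) at_top"
    by (intro tendsto_mult tendsto_const filterlim_compose[OF a(2)[rule_format] filterlim_imaginary_ray]) simp
  then have "((\<lambda>y. f (\<i> * of_real y) / of_real y) \<longlongrightarrow> \<i> * of_real a) at_top"
    by simp
  then have "\<i> * of_real a = \<i>"
    using hydrodynamic_expansion_ray(3)[OF exp] tendsto_unique[OF trivial_limit_at_top_linorder] by blast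
  then have "a = 1" by simp
  then show ?thesis using a(1) z by auto
qed

text \<open>Apply Schwarz--Pick to \<open>g\<close> at \<open>z\<close> and at iy, divide by
  \<open>y\<close> and let \<open>y\<close> grow: the decay \<open>Im (g (\<i> * y)) ~ c / y\<close>
  is balanced by |z - cnj(iy)|^2 ~ y^2. The limit is
  \<open>Im z * (norm (g z))\<^sup>2 \<le> c * Im (g z)\<close>.\<close>

lemma hydrodynamic_displacement_bound:
  assumes hol: "f holomorphic_on upper_half" and maps: "f ` upper_half \<subseteq> upper_half"
    and exp: "hydrodynamic_expansion f c" and z: "Im z > 0"
  shows "norm (f z - z) \<le> c / Im z"
proof -
  define g where "g z = f z - z" for z
  have nonneg: "Im (g z) \<ge> 0" if "Im z > 0" for z
    using hydrodynamic_Im_increasing[OF hol maps exp that] by (simp add: g_def)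
  have holg: "g holomorphic_on upper_half"
    unfolding g_def by (intro holomorphic_intros hol)
  let ?w = "\<lambda>y::real. \<i> * complex_of_real y"
  have pos: "\<forall>\<^sub>F y in at_top. (y::real) > 0" by (rule eventually_gt_at_top)
  have g1: "((\<lambda>y. ?w y * g (?w y)) \<longlongrightarrow> - of_real c) at_top"
    and g2: "((\<lambda>y. g (?w y)) \<longlongrightarrow> 0) at_top"
    using hydrodynamic_expansion_ray(1,2)[OF exp] by (simp_all add: g_def)
  have "((\<lambda>y. - Re (?w y * g (?w y))) \<longlongrightarrow> - Re (- of_real c)) at_top"
    by (intro tendsto_intros g1)
  \<comment> \<open>For w = iy the real part of w g(w) is - y Im g(w).\<close>
  then have g3: "((\<lambda>y. y * Im (g (?w y))) \<longlongrightarrow> c) at_top" by simp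
  have inv: "((\<lambda>y::real. inverse (of_real y) :: complex) \<longlongrightarrow> 0) at_top"
    by (rule filterlim_compose[OF tendsto_inverse_0])
       (simp add: filterlim_at_infinity_conv_norm_at_top filterlim_at_top_imp_at_infinity
         filterlim_abs_real)
  have lim: "((\<lambda>y. Im (g z) * (y * Im (g (?w y))) * (norm (z * inverse (of_real y) + \<i>))\<^sup>2) \<longlongrightarrow>
      Im (g z) * c * (norm (z * 0 + \<i>))\<^sup>2) at_top"
    by (intro tendsto_intros g3 inv)
  have lim2: "((\<lambda>y. Im z * (norm (g z - cnj (g (?w y))))\<^sup>2) \<longlongrightarrow> Im z * (norm (g z - cnj 0))\<^sup>2) at_top"
    by (intro tendsto_intros g2)
  have ev: "\<forall>\<^sub>F y in at_top. Im z * (norm (g z - cnj (g (?w y))))\<^sup>2 \<le>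
      Im (g z) * (y * Im (g (?w y))) * (norm (z * inverse (of_real y) + \<i>))\<^sup>2"
    using pos
  proof eventually_elim
    case (elim y)
    have "norm (z - cnj (?w y)) = norm (of_real y * (z * inverse (of_real y) + \<i>))"
      using elim by (simp add: algebra_simps)
    also have "\<dots> = y * norm (z * inverse (of_real y) + \<i>)"
      using elim by (simp add: norm_mult)
    finally have n: "norm (z - cnj (?w y)) = y * norm (z * inverse (of_real y) + \<i>)" .
    have "Im z * Im (?w y) * (norm (g z - cnj (g (?w y))))\<^sup>2 \<le> Im (g z) * Im (g (?w y)) * (norm (z - cnj (?w y)))\<^sup>2"
      by (rule schwarz_pick_half_plane_cnj[OF holg nonneg z]) (use elim in auto)
    then have "y * (Im z * (norm (g z - cnj (g (?w y))))\<^sup>2) \<le>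
      y * (Im (g z) * (y * Im (g (?w y))) * (norm (z * inverse (of_real y) + \<i>))\<^sup>2)"
      unfolding n by (simp add: power_mult_distrib power2_eq_square mult_ac)
    then show ?case using elim by simp
  qed
  have "Im z * (norm (g z))\<^sup>2 \<le> Im (g z) * c"
    using tendsto_le[OF trivial_limit_at_top_linorder lim lim2 ev] by simp
  also have "\<dots> \<le> norm (g z) * c"
    using exp abs_Im_le_cmod[of "g z"] by (intro mult_right_mono) (auto simp: hydrodynamic_expansion_def)
  finally have *: "norm (g z) * (Im z * norm (g z)) \<le> norm (g z) * c"
    by (simp add: power2_eq_square algebra_simps)
  have "c \<ge> 0" using exp by (simp add: hydrodynamic_expansion_def)
  with * have "Im z * norm (g z) \<le> c"
    by (cases "g z = 0") auto
  then show ?thesis using z by (simp add: g_def field_simps)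
qed

text \<open>The displacement of the composition at iy is that of \<open>h\<close> at iy plus that of
  \<open>f\<close> at h(iy). Since h(iy) is asymptotic to iy, the second one still has coefficient
  \<open>c\<close>.\<close>

lemma hydrodynamic_coefficient_additive:
  assumes f: "hydrodynamic_expansion f c" and h: "hydrodynamic_expansion h d"
    and k: "hydrodynamic_expansion k e" and comp: "\<And>z. Im z > 0 \<Longrightarrow> k z = f (h z)"
  shows "e = c + d"
proof -
  let ?w = "\<lambda>y::real. \<i> * complex_of_real y"
  let ?v = "\<lambda>y. h (?w y)"
  have hi: "((\<lambda>y. ?v y / of_real y) \<longlongrightarrow> \<i>) at_top"
    by (rule hydrodynamic_expansion_ray(3)[OF h])
  have "((\<lambda>z. z * (f z - z)) \<longlongrightarrow> - of_real c) (nontangential_at_infinity 1)"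
    using f hydrodynamic_expansion_iff by auto
  from filterlim_compose[OF this filterlim_nontangential_if_asymptotic_to_ray[OF hi]]
  have fv: "((\<lambda>y. ?v y * (f (?v y) - ?v y)) \<longlongrightarrow> - of_real c) at_top" .
  \<comment> \<open>The factor in front is iy / h(iy), which tends to 1 and replaces the weight
    h(iy) by iy.\<close>
  have lim: "((\<lambda>y. \<i> / (?v y / of_real y) * (?v y * (f (?v y) - ?v y)) + ?w y * (?v y - ?w y)) \<longlongrightarrow>
      \<i> / \<i> * - of_real c + - of_real d) at_top"
    by (intro tendsto_intros hi fv hydrodynamic_expansion_ray(1)[OF h]) simp
  have pos: "\<forall>\<^sub>F y in at_top. (y::real) > 0" by (rule eventually_gt_at_top)
  have nz: "\<forall>\<^sub>F y in at_top. ?v y / of_real y \<noteq> 0"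
    by (rule tendsto_imp_eventually_ne[OF hi]) simp
  have "\<forall>\<^sub>F y in at_top. \<i> / (?v y / of_real y) * (?v y * (f (?v y) - ?v y)) + ?w y * (?v y - ?w y)
      = ?w y * (k (?w y) - ?w y)"
    using pos nz by eventually_elim (simp add: comp field_simps)
  from Lim_transform_eventually[OF lim this]
  have "\<i> / \<i> * - of_real c + - of_real d = - complex_of_real e"
    using hydrodynamic_expansion_ray(1)[OF k] tendsto_unique[OF trivial_limit_at_top_linorder] by blast
  then have "complex_of_real (c + d) = of_real e" by (simp add: algebra_simps neg_eq_iff_add_eq_0)
  then show ?thesis using of_real_eq_iff by metis
qed

section \<open>Semigroups of hydrodynamic maps: necessity of the bound\<close>

lemma
  assumes "continuous_semigroup \<Omega> \<Phi>"
  shows semigroup_0: "z \<in> \<Omega> \<Longrightarrow> \<Phi> 0 z = z"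
    and semigroup_add: "s \<ge> 0 \<Longrightarrow> t \<ge> 0 \<Longrightarrow> z \<in> \<Omega> \<Longrightarrow> \<Phi> (t + s) z = \<Phi> t (\<Phi> s z)"
    and semigroup_holomorphic: "t \<ge> 0 \<Longrightarrow> \<Phi> t holomorphic_on \<Omega>"
    and semigroup_maps: "t \<ge> 0 \<Longrightarrow> \<Phi> t ` \<Omega> \<subseteq> \<Omega>"
    and semigroup_uniform_limit:
      "compact K \<Longrightarrow> K \<subseteq> \<Omega> \<Longrightarrow> uniform_limit K \<Phi> (\<lambda>z. z) (at_right 0)"
  using assms unfolding continuous_semigroup_def by blast+

lemma semigroup_tendsto_0:
  assumes sg: "continuous_semigroup \<Omega> \<Phi>" and z: "z \<in> \<Omega>"
  shows "((\<lambda>s. \<Phi> s z) \<longlongrightarrow> z) (at_right 0)"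
proof -
  have "uniform_limit {z} \<Phi> (\<lambda>z. z) (at_right 0)"
    using z by (intro semigroup_uniform_limit[OF sg]) auto
  from tendsto_uniform_limitI[OF this, of z] show ?thesis by simp
qed

text \<open>Integer multiples suffice, because the generator will be evaluated along the times
  1/(n+1).\<close>

lemma hydro_coeff_semigroup:
  assumes sg: "continuous_semigroup upper_half \<Phi>"
    and hyd: "\<And>t. t \<ge> 0 \<Longrightarrow> hydrodynamic_expansion (\<Phi> t) (l t)" and t: "t \<ge> 0"
  shows "l (real n * t) = real n * l t"
proof (induction n)
  case 0
  have "l 0 = l 0 + l 0"
    by (rule hydrodynamic_coefficient_additive[OF hyd hyd hyd]) (simp_all add: semigroup_0[OF sg])
  then show ?case by simp
next
  case (Suc n)
  have "l (t + real n * t) = l t + l (real n * t)"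
    using t by (intro hydrodynamic_coefficient_additive[OF hyd hyd hyd])
      (simp_all add: semigroup_add[OF sg])
  then show ?case using Suc by (simp add: algebra_simps)
qed

text \<open>With t = 1/(n+1), additivity gives l(t) = t l(1), so the displacement bound makes the
  difference quotient at most l(1) / Im z; then let n grow.\<close>

lemma K_half_imp_bound:
  assumes "H \<in> K_half c" and z: "Im z > 0"
  shows "norm (H z) \<le> c / Im z"
proof -
  from assms obtain \<Phi> where sg: "continuous_semigroup upper_half \<Phi>" and gen: "is_generator upper_half \<Phi> H"
    and hyd: "\<And>t. t \<ge> 0 \<Longrightarrow> \<Phi> t \<in> hydrodynamic_maps" and c: "hydro_coeff (\<Phi> 1) \<le> c"
    unfolding K_half_def by blast
  define l where "l t = hydro_coeff (\<Phi> t)" for t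
  have exp: "hydrodynamic_expansion (\<Phi> t) (l t)" if "t \<ge> 0" for t
    using hyd[OF that] hydro_coeff_eq unfolding hydrodynamic_maps_def l_def by fastforce
  let ?t = "\<lambda>n. inverse (real (Suc n))"
  have t0: "filterlim ?t (at_right 0) sequentially"
    using LIMSEQ_inverse_real_of_nat by (auto simp: filterlim_at simp del: of_nat_Suc)
  have "((\<lambda>t. (\<Phi> t z - z) / of_real t) \<longlongrightarrow> H z) (at_right 0)"
    using gen z by (simp add: is_generator_def)
  from tendsto_norm[OF filterlim_compose[OF this t0]]
  have lim: "(\<lambda>n. norm ((\<Phi> (?t n) z - z) / of_real (?t n))) \<longlonglongrightarrow> norm (H z)" .
  have "norm ((\<Phi> (?t n) z - z) / of_real (?t n)) \<le> c / Im z" for n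
  proof -
    have pos: "?t n > 0" by simp
    have "norm (\<Phi> (?t n) z - z) \<le> l (?t n) / Im z"
      using pos by (intro hydrodynamic_displacement_bound[OF _ _ exp z]
        semigroup_holomorphic[OF sg] semigroup_maps[OF sg]) auto
    moreover have "l (real (Suc n) * ?t n) = real (Suc n) * l (?t n)"
      by (rule hydro_coeff_semigroup[OF sg exp]) auto
    then have "l (?t n) = l 1 * ?t n" by (simp add: field_simps)
    ultimately have "norm (\<Phi> (?t n) z - z) \<le> ?t n * (l 1 / Im z)" by (simp add: mult_ac)
    also have "\<dots> \<le> ?t n * (c / Im z)"
      using c z pos by (intro mult_left_mono divide_right_mono) (auto simp: l_def)
    finally have "norm (\<Phi> (?t n) z - z) / ?t n \<le> c / Im z"
      using pos by (simp only: pos_divide_le_eq mult.commute)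
    then show ?thesis using pos by (simp only: norm_divide norm_of_real abs_of_pos)
  qed
  then show ?thesis using lim by (intro tendsto_upperbound[OF lim]) auto
qed

section \<open>Semigroups with bounded generator\<close>

text \<open>A mean value inequality with one-sided derivatives: the semigroup law gives right derivatives of
  trajectories for free, but not left ones.\<close>

lemma right_derivative_bound:
  fixes u :: "real \<Rightarrow> real"
  assumes T: "T \<ge> 0" and cont: "continuous_on {0..T} u"
    and der: "\<And>t. 0 \<le> t \<Longrightarrow> t < T \<Longrightarrow> ((\<lambda>s. (u (t + s) - u t) / s) \<longlongrightarrow> D t) (at_right 0)"
    and D: "\<And>t. 0 \<le> t \<Longrightarrow> t < T \<Longrightarrow> D t \<le> K"
  shows "u T \<le> u 0 + K * T"
proof (rule ccontr)
  assume neg: "\<not> ?thesis"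
  then have "T > 0" using T by (cases "T = 0") auto
  \<comment> \<open>Half of the mean excess: after removing the slope \<open>K + e\<close>, the
    function \<open>v\<close> still ends above its initial value.\<close>
  define e where "e = (u T - u 0 - K * T) / (2 * T)"
  have "e > 0" using neg \<open>T > 0\<close> by (simp add: e_def)
  define v where "v t = u t - (K + e) * t" for t
  have "e * T < u T - u 0 - K * T" using neg \<open>T > 0\<close> by (simp add: e_def)
  then have vT: "v T > v 0" by (simp add: v_def algebra_simps)
  have contv: "continuous_on {0..T} v" unfolding v_def by (intro continuous_intros cont)
  \<comment> \<open>The last time \<open>m\<close> with \<open>v m \<le> v 0\<close> lies before
    \<open>T\<close>, yet the right derivative of \<open>v\<close> at \<open>m\<close> is negative,
    which yields later points of \<open>S\<close>.\<close>
  define S where "S = {0..T} \<inter> v -` {..v 0}"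
  have "closed S" unfolding S_def
    by (rule continuous_closed_preimage[OF contv]) auto
  then have "compact S"
    unfolding S_def by (metis Int_absorb1 compact_Icc compact_Int_closed inf_le1)
  moreover have "0 \<in> S" using T by (simp add: S_def)
  ultimately obtain m where m: "m \<in> S" "\<And>t. t \<in> S \<Longrightarrow> t \<le> m"
    using compact_attains_sup[of S] by blast
  have m': "0 \<le> m" "m \<le> T" "v m \<le> v 0" using m(1) by (auto simp: S_def)
  then have "m < T" using vT by (cases "m = T") auto
  have "((\<lambda>s. (u (m + s) - u m) / s - (K + e)) \<longlongrightarrow> D m - (K + e)) (at_right 0)"
    by (intro tendsto_intros der m' \<open>m < T\<close>)
  moreover have "D m - (K + e) < 0" using D[OF m'(1) \<open>m < T\<close>] \<open>e > 0\<close> by simp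
  ultimately have "\<forall>\<^sub>F s in at_right 0. (u (m + s) - u m) / s - (K + e) < 0"
    by (rule order_tendstoD)
  moreover have "\<forall>\<^sub>F s in at_right 0. s < T - m"
    using \<open>m < T\<close> by (intro order_tendstoD[OF tendsto_ident_at]) simp
  moreover have "\<forall>\<^sub>F s in at_right (0::real). s > 0" by (rule eventually_at_right_less)
  ultimately have "\<forall>\<^sub>F s in at_right 0. m + s \<in> S \<and> s > 0"
  proof eventually_elim
    case (elim s)
    then have "u (m + s) - u m < (K + e) * s" by (simp add: field_simps)
    then have "v (m + s) \<le> v m" by (simp add: v_def algebra_simps)
    then show ?case using elim m' by (auto simp: S_def)
  qed
  then obtain s where "m + s \<in> S" "s > 0"
    using eventually_happens'[OF trivial_limit_at_right_real] by blast
  then show False using m(2) by fastforce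
qed

section \<open>Trajectories as functions of time\<close>

lemma semigroup_maps_upper_half:
  assumes "continuous_semigroup upper_half \<Phi>" "t \<ge> 0" "Im z > 0"
  shows "Im (\<Phi> t z) > 0"
  using semigroup_maps[OF assms(1,2)] assms(3) by auto

lemma semigroup_schwarz_pick:
  assumes sg: "continuous_semigroup upper_half \<Phi>" and t: "t \<ge> 0" and z: "Im z > 0" and w: "Im w > 0"
  shows "Im z * Im w * (norm (\<Phi> t z - \<Phi> t w))\<^sup>2 \<le> Im (\<Phi> t z) * Im (\<Phi> t w) * (norm (z - w))\<^sup>2"
  by (rule schwarz_pick_half_plane[OF semigroup_holomorphic[OF sg t] _ z w])
    (use semigroup_maps_upper_half[OF sg t] in \<open>simp add: less_imp_le\<close>)

lemma semigroup_tendsto_right: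
  assumes sg: "continuous_semigroup upper_half \<Phi>" and t: "t \<ge> 0" and z: "Im z > 0"
  shows "((\<lambda>s. \<Phi> (t + s) z) \<longlongrightarrow> \<Phi> t z) (at_right 0)"
proof -
  have "\<forall>\<^sub>F s in at_right 0. \<Phi> s (\<Phi> t z) = \<Phi> (t + s) z"
    by (rule eventually_mono[OF eventually_at_right_less])
      (use t z in \<open>simp add: semigroup_add[OF sg] add.commute[of t]\<close>)
  with semigroup_tendsto_0[OF sg, unfolded mem_Collect_eq, OF semigroup_maps_upper_half[OF sg t z]] show ?thesis
    by (rule Lim_transform_eventually)
qed

text \<open>Since \<Phi>(t) z is the image of \<Phi>(s) z under \<Phi>(t - s), a hyperbolic
  contraction, its distance from \<Phi>(t - s) z is at most that between \<Phi>(s) z and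
  \<open>z\<close>, which tends to 0.\<close>

lemma semigroup_tendsto_left:
  assumes sg: "continuous_semigroup upper_half \<Phi>" and t: "t > 0" and z: "Im z > 0"
  shows "((\<lambda>s. \<Phi> (t - s) z) \<longlongrightarrow> \<Phi> t z) (at_right 0)"
proof -
  define p where "p = \<Phi> t z"
  define P where "P = Im p"
  have P: "P > 0" using semigroup_maps_upper_half[OF sg _ z] t by (simp add: p_def P_def)
  \<comment> \<open>In terms of the hyperbolic distance d between \<Phi>(s) z and \<open>z\<close>,
    this is 2 (cosh d - 1).\<close>
  define \<kappa> where "\<kappa> s = (norm (\<Phi> s z - z))\<^sup>2 / (Im (\<Phi> s z) * Im z)" for s
  have "(\<kappa> \<longlongrightarrow> (norm (z - z))\<^sup>2 / (Im z * Im z)) (at_right 0)"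
    unfolding \<kappa>_def by (intro tendsto_intros semigroup_tendsto_0[OF sg, unfolded mem_Collect_eq, OF z]) (use z in auto)
  then have "((\<lambda>s. P * (\<kappa> s + sqrt (\<kappa> s))) \<longlongrightarrow> P * (0 + sqrt 0)) (at_right 0)"
    by (intro tendsto_intros) auto
  then have lim0: "((\<lambda>s. P * (\<kappa> s + sqrt (\<kappa> s))) \<longlongrightarrow> 0) (at_right 0)" by simp
  have "\<forall>\<^sub>F s in at_right 0. s < t" using t by (intro order_tendstoD[OF tendsto_ident_at])
  then have "\<forall>\<^sub>F s in at_right 0. norm (\<Phi> (t - s) z - p) \<le> P * (\<kappa> s + sqrt (\<kappa> s))"
    using eventually_at_right_less[of 0]
  proof eventually_elim
    case (elim s)
    define q where "q = \<Phi> (t - s) z"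
    define x where "x = norm (p - q)"
    have zs: "Im (\<Phi> s z) > 0" using semigroup_maps_upper_half[OF sg _ z] elim by simp
    have k0: "\<kappa> s \<ge> 0" using zs z by (simp add: \<kappa>_def)
    have "\<Phi> (t - s + s) z = \<Phi> (t - s) (\<Phi> s z)"
      using z elim by (intro semigroup_add[OF sg]) auto
    then have p: "p = \<Phi> (t - s) (\<Phi> s z)" by (simp add: p_def)
    have "Im (\<Phi> s z) * Im z * x\<^sup>2 \<le> P * Im q * (norm (\<Phi> s z - z))\<^sup>2"
      using semigroup_schwarz_pick[OF sg _ zs z, of "t - s"] elim
      by (simp add: x_def p[symmetric] q_def P_def)
    then have "x\<^sup>2 \<le> P * Im q * \<kappa> s"
      using zs z by (simp add: \<kappa>_def field_simps)
    also have "\<dots> \<le> P * (P + x) * \<kappa> s"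
      using abs_Im_le_cmod[of "p - q"] P k0
      by (intro mult_right_mono mult_left_mono) (auto simp: x_def P_def)
    finally have 1: "x * (x - P * \<kappa> s) \<le> \<kappa> s * P * P" by (simp add: power2_eq_square algebra_simps)
    \<comment> \<open>Solves the quadratic inequality \<open>1\<close>: if \<open>x\<close> were
      larger, both factors on its left would exceed \<open>P * sqrt (\<kappa> s)\<close>.\<close>
    have "x \<le> P * (\<kappa> s + sqrt (\<kappa> s))"
    proof (rule ccontr)
      assume "\<not> ?thesis"
      then have a: "x > P * (\<kappa> s + sqrt (\<kappa> s))" by simp
      have "P * sqrt (\<kappa> s) * (P * sqrt (\<kappa> s)) < x * (x - P * \<kappa> s)"
      proof (rule mult_strict_mono')
        show "P * sqrt (\<kappa> s) < x" using a P k0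
          by (smt (verit) distrib_left mult_nonneg_nonneg)
        show "P * sqrt (\<kappa> s) < x - P * \<kappa> s" using a by (simp add: algebra_simps)
      qed (use P k0 in auto)
      moreover have "P * sqrt (\<kappa> s) * (P * sqrt (\<kappa> s)) = \<kappa> s * P * P"
      proof -
        have "P * q * (P * q) = q * q * P * P" for q by (simp add: mult_ac)
        moreover have "sqrt (\<kappa> s) * sqrt (\<kappa> s) = \<kappa> s" using k0 by simp
        ultimately show ?thesis by presburger
      qed
      ultimately show False using 1 by linarith
    qed
    then show ?case by (simp add: x_def q_def norm_minus_commute)
  qed
  then have "((\<lambda>s. \<Phi> (t - s) z - p) \<longlongrightarrow> 0) (at_right 0)"
    using lim0 by (rule Lim_null_comparison)
  then show ?thesis by (simp add: p_def LIM_zero_iff)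
qed

lemma semigroup_continuous_in_time:
  assumes sg: "continuous_semigroup upper_half \<Phi>" and z: "Im z > 0"
  shows "continuous_on {0..T} (\<lambda>t. \<Phi> t z)"
proof (cases "T > 0")
  case False
  then have "{0..T} \<subseteq> {0}" by auto
  then show ?thesis using continuous_on_subset continuous_on_sing by blast
next
  case True
  have right: "((\<lambda>t. \<Phi> t z) \<longlongrightarrow> \<Phi> a z) (at_right a)" if "a \<ge> 0" for a
    using semigroup_tendsto_right[OF sg that z]
    by (subst filterlim_at_right_to_0) (simp add: add.commute)
  have left: "((\<lambda>t. \<Phi> t z) \<longlongrightarrow> \<Phi> a z) (at_left a)" if "a > 0" for a
    using semigroup_tendsto_left[OF sg that z]
    by (subst filterlim_at_left_to_right, subst filterlim_at_right_to_0) simp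
  show ?thesis
    unfolding continuous_on_def
  proof
    fix a assume a: "a \<in> {0..T}"
    show "((\<lambda>t. \<Phi> t z) \<longlongrightarrow> \<Phi> a z) (at a within {0..T})"
    proof (cases "a = 0")
      case True
      then show ?thesis using right[of 0] \<open>T > 0\<close> by (simp add: at_within_Icc_at_right)
    next
      case False
      then have "((\<lambda>t. \<Phi> t z) \<longlongrightarrow> \<Phi> a z) (at a)"
        using a left right by (intro filterlim_split_at) auto
      then show ?thesis by (rule tendsto_within_subset) simp
    qed
  qed
qed

lemma semigroup_right_derivative:
  assumes sg: "continuous_semigroup upper_half \<Phi>" and gen: "is_generator upper_half \<Phi> H"
    and t: "t \<ge> 0" and z: "Im z > 0"
  shows "((\<lambda>s. (\<Phi> (t + s) z - \<Phi> t z) / of_real s) \<longlongrightarrow> H (\<Phi> t z)) (at_right 0)"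
proof -
  have "((\<lambda>s. (\<Phi> s (\<Phi> t z) - \<Phi> t z) / of_real s) \<longlongrightarrow> H (\<Phi> t z)) (at_right 0)"
    using gen semigroup_maps_upper_half[OF sg t z] unfolding is_generator_def by blast
  moreover have "\<forall>\<^sub>F s in at_right 0. (\<Phi> s (\<Phi> t z) - \<Phi> t z) / of_real s = (\<Phi> (t + s) z - \<Phi> t z) / of_real s"
    by (rule eventually_mono[OF eventually_at_right_less])
      (use t z in \<open>simp add: semigroup_add[OF sg] add.commute[of t]\<close>)
  ultimately show ?thesis by (rule Lim_transform_eventually)
qed

section \<open>Infinitesimal Schwarz--Pick and displacement bounds\<close>

text \<open>The derivative of the Schwarz--Pick inequality at \<open>t = 0\<close>, where both of its sides agree.\<close>

lemma generator_inequality: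
  assumes sg: "continuous_semigroup upper_half \<Phi>" and gen: "is_generator upper_half \<Phi> H"
    and z: "Im z > 0" and w: "Im w > 0"
  shows "Im z * Im w * (2 * Re ((H z - H w) * cnj (z - w)))
    \<le> (Im (H z) * Im w + Im z * Im (H w)) * (norm (z - w))\<^sup>2"
proof -
  define u where "u z t = (\<Phi> t z - z) / of_real t" for z t
  have u: "((\<lambda>t. u z t) \<longlongrightarrow> H z) (at_right 0)" if "Im z > 0" for z
    using gen that by (simp add: is_generator_def u_def)
  \<comment> \<open>\<open>?L\<close> and \<open>?R\<close> are the two sides of Schwarz--Pick with
    their common value at time 0 subtracted, divided by \<open>t\<close>.\<close>
  let ?L = "\<lambda>t. Im z * Im w * (2 * Re ((u z t - u w t) * cnj (z - w)) + t * (norm (u z t - u w t))\<^sup>2)"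
  let ?R = "\<lambda>t. (Im (u z t) * Im w + Im z * Im (u w t) + t * (Im (u z t) * Im (u w t))) * (norm (z - w))\<^sup>2"
  have L: "(?L \<longlongrightarrow> Im z * Im w * (2 * Re ((H z - H w) * cnj (z - w)) + 0 * (norm (H z - H w))\<^sup>2)) (at_right 0)"
    by (intro tendsto_intros u z w)
  have R: "(?R \<longlongrightarrow> (Im (H z) * Im w + Im z * Im (H w) + 0 * (Im (H z) * Im (H w))) * (norm (z - w))\<^sup>2) (at_right 0)"
    by (intro tendsto_intros u z w)
  have "\<forall>\<^sub>F t in at_right 0. ?L t \<le> ?R t"
    using eventually_at_right_less
  proof eventually_elim
    case (elim t)
    have \<Phi>: "\<Phi> t z = z + of_real t * u z t" for z using elim by (simp add: u_def)
    have d: "\<Phi> t z - \<Phi> t w = (z - w) + of_real t * (u z t - u w t)" by (simp add: \<Phi> algebra_simps)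
    have n: "(norm (a + of_real t * b))\<^sup>2 = (norm a)\<^sup>2 + t * (2 * Re (b * cnj a) + t * (norm b)\<^sup>2)" for a b
      unfolding cmod_power2 by (simp add: power2_eq_square algebra_simps)
    have I: "Im (\<Phi> t z) * Im (\<Phi> t w) = Im z * Im w + t * (Im (u z t) * Im w + Im z * Im (u w t) + t * (Im (u z t) * Im (u w t)))"
      by (simp add: \<Phi> algebra_simps)
    have "t * ?L t \<le> t * ?R t"
      using semigroup_schwarz_pick[OF sg _ z w, of t] elim unfolding d n I
      by (simp add: algebra_simps)
    then show ?case using elim by simp
  qed
  from tendsto_le[OF _ R L this] show ?thesis by simp
qed

text \<open>Take w = iy in the preceding inequality and divide by y^3. As \<open>H\<close> is
  bounded along the axis and even tends to 0, the left side vanishes in the limit and the right side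
  tends to \<open>Im (H z)\<close>.\<close>

lemma generator_Im_nonneg:
  assumes sg: "continuous_semigroup upper_half \<Phi>" and gen: "is_generator upper_half \<Phi> H"
    and bound: "\<And>z. Im z > 0 \<Longrightarrow> norm (H z) \<le> c / Im z" and z: "Im z > 0"
  shows "Im (H z) \<ge> 0"
proof -
  let ?w = "\<lambda>y::real. \<i> * complex_of_real y"
  have pos: "\<forall>\<^sub>F y in at_top. (y::real) > 0" by (rule eventually_gt_at_top)
  have r: "((\<lambda>y::real. inverse y) \<longlongrightarrow> 0) at_top" by (rule tendsto_inverse_0_at_top[OF filterlim_ident])
  then have inv: "((\<lambda>y::real. inverse (of_real y) :: complex) \<longlongrightarrow> 0) at_top"
    unfolding of_real_inverse[symmetric] by (metis of_real_0 tendsto_of_real)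
  have "((\<lambda>y. c * inverse y) \<longlongrightarrow> c * 0) at_top" by (intro tendsto_intros r)
  then have lim: "((\<lambda>y. c * inverse y) \<longlongrightarrow> 0) at_top" by simp
  have "\<forall>\<^sub>F y in at_top. norm (H (?w y)) \<le> c * inverse y"
    using pos
  proof eventually_elim
    case (elim y)
    then show ?case using bound[of "?w y"] by (simp add: divide_inverse)
  qed
  then have Hw: "((\<lambda>y. H (?w y)) \<longlongrightarrow> 0) at_top"
    using lim by (rule Lim_null_comparison)
  let ?L = "\<lambda>y. Im z * (2 * Re ((H z - H (?w y)) * inverse (of_real y) * cnj (z * inverse (of_real y) - \<i>)))"
  let ?R = "\<lambda>y. (Im (H z) + Im z * (Im (H (?w y)) * inverse y)) * (norm (z * inverse (of_real y) - \<i>))\<^sup>2"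
  have L: "(?L \<longlongrightarrow> Im z * (2 * Re ((H z - 0) * 0 * cnj (z * 0 - \<i>)))) at_top"
    by (intro tendsto_intros inv Hw)
  have R: "(?R \<longlongrightarrow> (Im (H z) + Im z * (Im 0 * 0)) * (norm (z * 0 - \<i>))\<^sup>2) at_top"
    by (intro tendsto_intros inv Hw r)
  have "\<forall>\<^sub>F y in at_top. ?L y \<le> ?R y"
    using pos
  proof eventually_elim
    case (elim y)
    define \<zeta> where "\<zeta> = z * inverse (of_real y) - \<i>"
    have zw: "z - ?w y = of_real y * \<zeta>" using elim by (simp add: field_simps \<zeta>_def)
    have n: "(norm (z - ?w y))\<^sup>2 = y\<^sup>2 * (norm \<zeta>)\<^sup>2"
      unfolding zw by (simp add: norm_mult power_mult_distrib)
    have re: "Re ((H z - H (?w y)) * cnj (z - ?w y)) = y\<^sup>2 * Re ((H z - H (?w y)) * inverse (of_real y) * cnj \<zeta>)"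
    proof -
      have "(H z - H (?w y)) * cnj (z - ?w y) = of_real (y\<^sup>2) * ((H z - H (?w y)) * inverse (of_real y) * cnj \<zeta>)"
        unfolding zw using elim by (simp add: power2_eq_square field_simps)
      moreover have "Re (of_real r * x) = r * Re x" for r x by simp
      ultimately show ?thesis by presburger
    qed
    have "Im z * Im (?w y) * (2 * Re ((H z - H (?w y)) * cnj (z - ?w y)))
      \<le> (Im (H z) * Im (?w y) + Im z * Im (H (?w y))) * (norm (z - ?w y))\<^sup>2"
      by (rule generator_inequality[OF sg gen z]) (use elim in simp)
    also have "Im z * Im (?w y) * (2 * Re ((H z - H (?w y)) * cnj (z - ?w y))) = y ^ 3 * ?L y"
      unfolding re \<zeta>_def[symmetric] by (simp add: eval_nat_numeral)
    also have "(Im (H z) * Im (?w y) + Im z * Im (H (?w y))) * (norm (z - ?w y))\<^sup>2 = y ^ 3 * ?R y"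
      unfolding n \<zeta>_def[symmetric] using elim by (simp add: eval_nat_numeral field_simps)
    finally show ?case using elim by simp
  qed
  from tendsto_le[OF _ R L this] show ?thesis by simp
qed

text \<open>A nonnegative \<open>Im H\<close> keeps each trajectory above its starting height, so
  \<open>c / Im z\<close> bounds the speed along the whole of it. The one-sided mean value
  inequality integrates both facts.\<close>

lemma bounded_generator_semigroup_bounds:
  assumes sg: "continuous_semigroup upper_half \<Phi>" and gen: "is_generator upper_half \<Phi> H"
    and bound: "\<And>z. Im z > 0 \<Longrightarrow> norm (H z) \<le> c / Im z" and c: "c \<ge> 0"
    and z: "Im z > 0" and T: "T \<ge> 0"
  shows "Im z \<le> Im (\<Phi> T z)" and "norm (\<Phi> T z - z) \<le> c * T / Im z"
proof -
  have \<Phi>0: "\<Phi> 0 z = z" using z by (simp add: semigroup_0[OF sg])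
  have cont: "continuous_on {0..T} (\<lambda>t. \<Phi> t z)" for T
    by (rule semigroup_continuous_in_time[OF sg z])
  note der = semigroup_right_derivative[OF sg gen _ z]
  have up: "Im (\<Phi> t z) > 0" if "t \<ge> 0" for t by (rule semigroup_maps_upper_half[OF sg that z])
  have mono: "Im z \<le> Im (\<Phi> T z)" if "T \<ge> 0" for T
  proof -
    have "- Im (\<Phi> T z) \<le> - Im (\<Phi> 0 z) + 0 * T"
    proof (rule right_derivative_bound[OF that])
      show "continuous_on {0..T} (\<lambda>t. - Im (\<Phi> t z))" by (intro continuous_intros cont)
      show "((\<lambda>s. (- Im (\<Phi> (t + s) z) - - Im (\<Phi> t z)) / s) \<longlongrightarrow> - Im (H (\<Phi> t z))) (at_right 0)"
        if "0 \<le> t" for t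
        using tendsto_minus[OF tendsto_Im[OF der[OF that]]] by (simp add: minus_divide_left)
      show "- Im (H (\<Phi> t z)) \<le> 0" if "0 \<le> t" for t
        using generator_Im_nonneg[OF sg gen bound up[OF that]] by simp
    qed
    then show ?thesis by (simp add: \<Phi>0)
  qed
  show "Im z \<le> Im (\<Phi> T z)" by (rule mono[OF T])
  show "norm (\<Phi> T z - z) \<le> c * T / Im z"
  proof -
    \<comment> \<open>Projecting onto the direction of the final displacement makes the problem
      real-valued without losing its norm; if that displacement is 0, then
      \<open>e = 0\<close>.\<close>
    define e where "e = cnj (sgn (\<Phi> T z - z))"
    have e: "norm e \<le> 1" by (simp add: e_def norm_sgn)
    have "Re (\<Phi> T z * e) \<le> Re (\<Phi> 0 z * e) + c / Im z * T"
    proof (rule right_derivative_bound[OF T])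
      show "continuous_on {0..T} (\<lambda>t. Re (\<Phi> t z * e))" by (intro continuous_intros cont)
      show "((\<lambda>s. (Re (\<Phi> (t + s) z * e) - Re (\<Phi> t z * e)) / s) \<longlongrightarrow> Re (H (\<Phi> t z) * e)) (at_right 0)"
        if "0 \<le> t" for t
      proof -
        have "(\<lambda>s. Re ((\<Phi> (t + s) z - \<Phi> t z) / of_real s * e)) = (\<lambda>s. (Re (\<Phi> (t + s) z * e) - Re (\<Phi> t z * e)) / s)"
          by (simp add: fun_eq_iff algebra_simps diff_divide_distrib add_divide_distrib)
        then show ?thesis
          using tendsto_Re[OF tendsto_mult[OF der[OF that] tendsto_const[of e]]] by simp
      qed
      show "Re (H (\<Phi> t z) * e) \<le> c / Im z" if "0 \<le> t" for t
      proof -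
        have "Re (H (\<Phi> t z) * e) \<le> norm (H (\<Phi> t z)) * norm e"
          by (metis complex_Re_le_cmod norm_mult)
        also have "\<dots> \<le> norm (H (\<Phi> t z))" using e by (simp add: mult_left_le)
        also have "\<dots> \<le> c / Im (\<Phi> t z)" by (rule bound[OF up[OF that]])
        also have "\<dots> \<le> c / Im z" using mono[OF that] z c by (intro divide_left_mono) (auto simp: up that)
        finally show ?thesis .
      qed
    qed
    then have "Re ((\<Phi> T z - z) * e) \<le> c * T / Im z" by (simp add: \<Phi>0 algebra_simps)
    moreover have "(\<Phi> T z - z) * e = of_real (norm (\<Phi> T z - z))"
    proof -
      define d where "d = \<Phi> T z - z"
      have "d * e = d * cnj d / of_real (norm d)" by (simp add: e_def d_def sgn_eq)
      also have "\<dots> = of_real ((norm d)\<^sup>2) / of_real (norm d)" by (simp only: complex_norm_square)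
      also have "\<dots> = of_real (norm d)" by (simp add: power2_eq_square)
      finally show ?thesis by (simp add: d_def)
    qed
    ultimately show ?thesis by simp
  qed
qed

section \<open>Hydrodynamic expansion from decay\<close>

text \<open>\<open>m\<close> is the reciprocal of the angular derivative of \<open>- 1 / g\<close>, unless \<open>g = 0\<close>.\<close>

lemma angular_residue_at_infinity:
  assumes hol: "g holomorphic_on upper_half"
    and nonneg: "\<And>z. Im z > 0 \<Longrightarrow> Im (g z) \<ge> 0"
    and bound: "\<And>z. Im z > 0 \<Longrightarrow> norm (g z) \<le> C / Im z"
  shows "\<exists>m\<ge>0. m \<le> C \<and>
    (\<forall>\<delta>>0. ((\<lambda>z. z * g z) \<longlongrightarrow> - of_real m) (nontangential_at_infinity \<delta>))"
proof (cases "\<forall>z. Im z > 0 \<longrightarrow> Im (g z) > 0")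
  case False
  then obtain w where w: "Im w > 0" "Im (g w) = 0" using nonneg by force
  \<comment> \<open>An interior zero of \<open>Im g\<close> makes the right side of Schwarz--Pick
    vanish, so \<open>g\<close> is constant; the decay along the axis then leaves only
    \<open>g = 0\<close> and the residue 0.\<close>
  have const: "g z = g w" if "Im z > 0" for z
    using schwarz_pick_half_plane[OF hol nonneg that w(1)] that w
    by (simp add: mult_le_0_iff)
  have C: "C \<ge> 0" using order_trans[OF norm_ge_zero bound[of \<i>]] by simp
  have "((\<lambda>y. C * inverse y) \<longlongrightarrow> C * 0) at_top"
    by (intro tendsto_intros tendsto_inverse_0_at_top[OF filterlim_ident])
  moreover have "\<forall>\<^sub>F y in at_top. norm (g w) \<le> C * inverse y"
  proof (rule eventually_mono[OF eventually_gt_at_top[of 0]])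
    fix y :: real assume y: "y > 0"
    show "norm (g w) \<le> C * inverse y"
      using bound[of "\<i> * of_real y"] const[of "\<i> * of_real y"] y by (simp add: field_simps)
  qed
  ultimately have "norm (g w) \<le> C * 0"
    by (intro tendsto_lowerbound[of "\<lambda>y. C * inverse y"]) auto
  then have "g w = 0" by simp
  show ?thesis
  proof (intro exI[of _ 0] conjI allI impI)
    fix \<delta> :: real assume "\<delta> > 0"
    show "((\<lambda>z. z * g z) \<longlongrightarrow> - of_real 0) (nontangential_at_infinity \<delta>)"
      by (rule tendsto_eventually, rule eventually_mono[OF eventually_sector[OF \<open>\<delta> > 0\<close>, of 0]])
        (use const \<open>g w = 0\<close> in auto)
  qed (use C in auto)
next
  case True
  define F where "F z = - inverse (g z)" for z
  have nz: "g z \<noteq> 0" if "Im z > 0" for z using True that by force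
  have holF: "F holomorphic_on upper_half"
    unfolding F_def using nz by (intro holomorphic_intros hol) auto
  have ImF: "Im (F z) \<ge> 0" if "Im z > 0" for z
    using nonneg[OF that] by (simp add: F_def)
  from angular_derivative_at_infinity[OF holF ImF]
  obtain a where a: "a \<ge> 0"
    "\<forall>\<delta>>0. ((\<lambda>z. F z / z) \<longlongrightarrow> of_real a) (nontangential_at_infinity \<delta>)"
    by blast
  have "C > 0" using less_le_trans[of 0 "norm (g \<i>)" C] bound[of \<i>] nz[of \<i>] by simp
  have "((\<lambda>y. norm (F (\<i> * of_real y) / (\<i> * of_real y))) \<longlongrightarrow> norm (complex_of_real a)) at_top"
    by (intro tendsto_norm filterlim_compose[OF a(2)[rule_format] filterlim_imaginary_ray]) simp
  \<comment> \<open>On the axis |F(iy) / (iy)| = 1 / (y |g(iy)|), and the decay bound gives y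
    |g(iy)| <= C.\<close>
  then have "inverse C \<le> norm (complex_of_real a)"
  proof (rule tendsto_lowerbound)
    show "\<forall>\<^sub>F y in at_top. inverse C \<le> norm (F (\<i> * of_real y) / (\<i> * of_real y))"
    proof (rule eventually_mono[OF eventually_gt_at_top[of 0]])
      fix y :: real assume y: "y > 0"
      have "norm (g (\<i> * of_real y)) \<le> C / y" using bound[of "\<i> * of_real y"] y by simp
      then show "inverse C \<le> norm (F (\<i> * of_real y) / (\<i> * of_real y))"
        using y nz[of "\<i> * of_real y"] \<open>C > 0\<close>
        by (simp add: F_def norm_divide norm_inverse norm_mult field_simps)
    qed
  qed simp
  then have a': "inverse C \<le> a" using a(1) by simp
  have "a > 0" using a' \<open>C > 0\<close> by (smt (verit) positive_imp_inverse_positive)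
  show ?thesis
  proof (intro exI[of _ "inverse a"] conjI allI impI)
    show "0 \<le> inverse a" using a by simp
    show "inverse a \<le> C" using a' \<open>a > 0\<close> \<open>C > 0\<close> by (simp add: field_simps)
    fix \<delta> :: real assume "\<delta> > 0"
    have "((\<lambda>z. - inverse (F z / z)) \<longlongrightarrow> - inverse (of_real a)) (nontangential_at_infinity \<delta>)"
      using \<open>a > 0\<close> by (intro tendsto_intros a(2)[rule_format] \<open>\<delta> > 0\<close>) auto
    then show "((\<lambda>z. z * g z) \<longlongrightarrow> - of_real (inverse a)) (nontangential_at_infinity \<delta>)"
      by (simp add: F_def field_simps)
  qed
qed

section \<open>Univalence of the semigroup maps\<close>

text \<open>For small \<open>s\<close> the displacement is uniformly small near \<open>p\<close>;
  Cauchy's estimate makes it a contraction with constant 1/2, and the identity plus such a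
  contraction is injective. One radius serves all small \<open>s\<close>.\<close>

lemma semigroup_locally_injective:
  assumes sg: "continuous_semigroup upper_half \<Phi>" and p: "Im p > 0"
  obtains r where "r > 0" "\<forall>\<^sub>F s in at_right 0. inj_on (\<Phi> s) (ball p r)"
proof -
  \<comment> \<open>Circles of radius \<open>r\<close> about points of \<open>ball p r\<close> then
    stay in \<open>cball p (2 * r)\<close>, inside the half-plane.\<close>
  define r where "r = Im p / 4"
  have "r > 0" using p by (simp add: r_def)
  have sub: "cball p (2 * r) \<subseteq> upper_half"
  proof
    fix x assume "x \<in> cball p (2 * r)"
    then have "\<bar>Im (p - x)\<bar> \<le> 2 * r" using abs_Im_le_cmod[of "p - x"] by (simp add: dist_norm)
    then have "\<bar>Im p - Im x\<bar> \<le> Im p / 2" by (simp add: r_def)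
    then have "Im x > 0" using p by linarith
    then show "x \<in> upper_half" by simp
  qed
  have "uniform_limit (cball p (2 * r)) \<Phi> (\<lambda>z. z) (at_right 0)"
    using sub by (intro semigroup_uniform_limit[OF sg]) auto
  then have "\<forall>\<^sub>F s in at_right 0. \<forall>x\<in>cball p (2 * r). dist (\<Phi> s x) x < r / 2"
    using \<open>r > 0\<close> by (intro uniform_limitD) auto
  then have "\<forall>\<^sub>F s in at_right 0. inj_on (\<Phi> s) (ball p r)"
    using eventually_at_right_less
  proof eventually_elim
    case (elim s)
    define g where "g x = \<Phi> s x - x" for x
    have holg: "g holomorphic_on upper_half"
      unfolding g_def using elim by (intro holomorphic_intros semigroup_holomorphic[OF sg]) auto
    have "norm (g x - g y) \<le> 1 / 2 * norm (x - y)" if "x \<in> ball p r" "y \<in> ball p r" for x y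
    proof (rule field_differentiable_bound[OF convex_ball _ _ that, where f' = "deriv g"])
      fix x assume x: "x \<in> ball p r"
      have xs: "cball x r \<subseteq> cball p (2 * r)"
        using x by (simp add: cball_subset_cball_iff dist_commute)
      then have xs': "cball x r \<subseteq> upper_half" using sub by blast
      have "x \<in> upper_half" using subsetD[OF xs', of x] \<open>r > 0\<close> by simp
      moreover have "open upper_half" by (rule open_halfspace_Im_gt)
      ultimately show "(g has_field_derivative deriv g x) (at x within ball p r)"
        using holg holomorphic_derivI by blast
      have "norm ((deriv ^^ 1) g x) \<le> fact 1 * (r / 2) / r ^ 1"
      proof (rule Cauchy_inequality)
        show "g holomorphic_on ball x r" "continuous_on (cball x r) g"
          using holg xs' ball_subset_cball holomorphic_on_subset holomorphic_on_imp_continuous_on by blast+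
        show "norm (g y) \<le> r / 2" if "norm (x - y) = r" for y
        proof -
          have "y \<in> cball p (2 * r)" using xs that by (auto simp: dist_norm)
          then show ?thesis using elim by (auto simp: g_def dist_norm less_imp_le)
        qed
      qed fact
      then show "norm (deriv g x) \<le> 1 / 2" using \<open>r > 0\<close> by simp
    qed
    then show ?case
      unfolding inj_on_def g_def by (fastforce simp: norm_minus_commute)
  qed
  then show ?thesis using that \<open>r > 0\<close> by blast
qed

text \<open>At the first time \<open>\<tau>\<close> at which two trajectories meet, they are close to the meeting point just before \<open>\<tau>\<close>,
  where \<open>\<Phi>\<^sub>s\<close> is injective for small \<open>s\<close>.\<close>

lemma semigroup_injective:
  assumes sg: "continuous_semigroup upper_half \<Phi>" and T: "T \<ge> 0"
  shows "inj_on (\<Phi> T) upper_half"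
proof (rule inj_onI, rule ccontr)
  fix x y assume x: "x \<in> upper_half" and y: "y \<in> upper_half" and eq: "\<Phi> T x = \<Phi> T y" and "x \<noteq> y"
  have cont: "continuous_on {0..T} (\<lambda>t. \<Phi> t x - \<Phi> t y)"
    using x y by (intro continuous_intros semigroup_continuous_in_time[OF sg]) auto
  \<comment> \<open>The meeting times form a closed set, so a first one exists; it is positive
    because the starting points differ.\<close>
  define S where "S = {0..T} \<inter> (\<lambda>t. \<Phi> t x - \<Phi> t y) -` {0}"
  have "closed S" unfolding S_def by (rule continuous_closed_preimage[OF cont]) auto
  then have "compact S"
    unfolding S_def by (metis Int_absorb1 compact_Icc compact_Int_closed inf_le1)
  moreover have "T \<in> S" using T eq by (simp add: S_def)
  ultimately obtain \<tau> where \<tau>: "\<tau> \<in> S" "\<And>t. t \<in> S \<Longrightarrow> \<tau> \<le> t"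
    using compact_attains_inf[of S] by blast
  have "\<Phi> 0 x \<noteq> \<Phi> 0 y" using x y \<open>x \<noteq> y\<close> by (simp add: semigroup_0[OF sg])
  then have \<tau>': "0 < \<tau>" "\<tau> \<le> T" "\<Phi> \<tau> x = \<Phi> \<tau> y"
    using \<tau>(1) by (auto simp: S_def less_le)
  define p where "p = \<Phi> \<tau> x"
  have "Im p > 0" using semigroup_maps_upper_half[OF sg, of \<tau> x] \<tau>'(1) x by (simp add: p_def)
  then obtain r where r: "r > 0" "\<forall>\<^sub>F s in at_right 0. inj_on (\<Phi> s) (ball p r)"
    using semigroup_locally_injective[OF sg] by blast
  have near: "\<forall>\<^sub>F s in at_right 0. \<Phi> (\<tau> - s) w \<in> ball p r" if "Im w > 0" "\<Phi> \<tau> w = p" for w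
    using tendstoD[OF semigroup_tendsto_left[OF sg \<tau>'(1) that(1)] r(1)] that(2)
    by (simp add: dist_commute)
  have "\<forall>\<^sub>F s in at_right 0. \<Phi> (\<tau> - s) x \<in> ball p r" "\<forall>\<^sub>F s in at_right 0. \<Phi> (\<tau> - s) y \<in> ball p r"
    using near[of x] near[of y] x y \<tau>'(3) by (simp_all add: p_def)
  moreover have "\<forall>\<^sub>F s in at_right 0. s < \<tau>" using \<tau>' by (intro order_tendstoD[OF tendsto_ident_at])
  ultimately have "\<forall>\<^sub>F s in at_right (0::real). False"
    using r(2) eventually_at_right_less
  proof eventually_elim
    case (elim s)
    have "\<Phi> (s + (\<tau> - s)) z = \<Phi> s (\<Phi> (\<tau> - s) z)" if "z \<in> upper_half" for z
      using that elim by (intro semigroup_add[OF sg]) auto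
    then have "\<Phi> s (\<Phi> (\<tau> - s) x) = \<Phi> s (\<Phi> (\<tau> - s) y)"
      using x y \<tau>'(3) by fastforce
    then have "\<Phi> (\<tau> - s) x = \<Phi> (\<tau> - s) y"
      using elim by (auto dest: inj_onD)
    then have "\<tau> - s \<in> S" using elim \<tau>' by (simp add: S_def)
    then show ?case using \<tau>(2) elim by fastforce
  qed
  then show False by simp
qed

text \<open>The semigroup that \<open>H\<close> generates is itself the witness: its displacement at
  time \<open>t\<close> decays like \<open>c * t / Im z\<close>, which yields an expansion with
  coefficient at most \<open>c * t\<close>.\<close>

lemma bound_imp_K_half:
  assumes H: "H \<in> Inf_gen upper_half" and c: "c \<ge> 0"
    and bound: "\<And>z. Im z > 0 \<Longrightarrow> norm (H z) \<le> c / Im z"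
  shows "H \<in> K_half c"
proof -
  obtain \<Phi> where sg: "continuous_semigroup upper_half \<Phi>" and gen: "is_generator upper_half \<Phi> H"
    using H unfolding Inf_gen_def by blast
  have exp: "\<exists>m\<le>c * t. hydrodynamic_expansion (\<Phi> t) m" if t: "t \<ge> 0" for t
  proof -
    note bounds = bounded_generator_semigroup_bounds[OF sg gen bound c _ t]
    have "(\<lambda>z. \<Phi> t z - z) holomorphic_on upper_half"
      by (intro holomorphic_intros semigroup_holomorphic[OF sg t])
    from angular_residue_at_infinity[OF this, of "c * t"] bounds
    have "\<exists>m\<ge>0. m \<le> c * t \<and> (\<forall>\<delta>>0. ((\<lambda>z. z * (\<Phi> t z - z)) \<longlongrightarrow> - of_real m) (nontangential_at_infinity \<delta>))"
      by simp
    then show ?thesis unfolding hydrodynamic_expansion_iff by blast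
  qed
  have "\<Phi> t \<in> hydrodynamic_maps" if "t \<ge> 0" for t
    using exp[OF that] semigroup_injective[OF sg that] semigroup_holomorphic[OF sg that]
      semigroup_maps[OF sg that]
    unfolding hydrodynamic_maps_def by blast
  moreover have "hydro_coeff (\<Phi> 1) \<le> c"
    using exp[of 1] hydro_coeff_eq by auto
  ultimately show ?thesis using sg gen unfolding K_half_def by blast
qed

section \<open>Transfer to the disc\<close>

text \<open>A closed formula makes holomorphy and differences computable; \<open>inv_into\<close> is
  only ever evaluated at points \<open>cayley z\<close>.\<close>

definition cayley_inv :: "complex \<Rightarrow> complex" where
  "cayley_inv w = \<i> * (1 + w) / (1 - w)"

lemma plus_i_nonzero: "Im z > 0 \<Longrightarrow> z + \<i> \<noteq> 0"
  by (auto simp: complex_eq_iff)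

lemma cayley_in_unit_disc: "Im z > 0 \<Longrightarrow> norm (cayley z) < 1"
  using bij_betwE[OF bij_betw_cayley] by auto

lemma one_minus_cayley: "Im z > 0 \<Longrightarrow> 1 - cayley z = 2 * \<i> / (z + \<i>)"
  using plus_i_nonzero[of z] by (simp add: cayley_def field_simps)

lemma cayley_inv_cayley:
  assumes "Im z > 0"
  shows "cayley_inv (cayley z) = z"
proof -
  have "1 + cayley z = 2 * z / (z + \<i>)"
    using plus_i_nonzero[OF assms] by (simp add: cayley_def field_simps)
  then show ?thesis
    using plus_i_nonzero[OF assms] by (simp add: cayley_inv_def one_minus_cayley[OF assms])
qed

lemma unit_disc_cayleyE:
  assumes "norm w < 1"
  obtains z where "Im z > 0" "w = cayley z"
  using assms bij_betw_imp_surj_on[OF bij_betw_cayley] by blast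

lemma inv_into_cayley: "Im z > 0 \<Longrightarrow> inv_into upper_half cayley (cayley z) = z"
  using bij_betw_imp_inj_on[OF bij_betw_cayley] by (simp add: inv_into_f_f)

lemma cayley_inv_in_upper_half:
  assumes "norm w < 1" shows "Im (cayley_inv w) > 0"
  using assms by (metis cayley_inv_cayley unit_disc_cayleyE)

lemma cayley_cayley_inv:
  assumes "norm w < 1" shows "cayley (cayley_inv w) = w"
  using assms by (metis cayley_inv_cayley unit_disc_cayleyE)

text \<open>This exact identity splits the difference quotient of the transported semigroup into the
  one on the disc and a factor with a limit.\<close>

lemma cayley_inv_diff:
  assumes "a \<noteq> 1" "b \<noteq> 1"
  shows "cayley_inv a - cayley_inv b = 2 * \<i> * (a - b) / ((1 - a) * (1 - b))"
  using assms by (simp add: cayley_inv_def field_simps)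

lemma holomorphic_cayley: "cayley holomorphic_on upper_half"
  unfolding cayley_def using plus_i_nonzero by (intro holomorphic_intros) auto

lemma holomorphic_cayley_inv: "cayley_inv holomorphic_on unit_disc"
  unfolding cayley_inv_def by (intro holomorphic_intros) auto

lemma deriv_cayley:
  assumes "Im z > 0"
  shows "deriv cayley z = 2 * \<i> / (z + \<i>)\<^sup>2"
proof (rule DERIV_imp_deriv)
  show "(cayley has_field_derivative 2 * \<i> / (z + \<i>)\<^sup>2) (at z)"
    unfolding cayley_def using plus_i_nonzero[OF assms]
    by (auto intro!: derivative_eq_intros simp: power2_eq_square)
qed

lemma one_minus_norm_cayley:
  assumes "Im z > 0"
  shows "1 - (norm (cayley z))\<^sup>2 = 4 * Im z / (norm (z + \<i>))\<^sup>2"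
proof -
  have "(norm (z + \<i>))\<^sup>2 - (norm (z - \<i>))\<^sup>2 = 4 * Im z"
    unfolding cmod_power2 by (simp add: power2_eq_square algebra_simps)
  moreover have "(norm (cayley z))\<^sup>2 = (norm (z - \<i>))\<^sup>2 / (norm (z + \<i>))\<^sup>2"
    by (simp add: cayley_def norm_divide power_divide)
  then have "1 - (norm (cayley z))\<^sup>2 = ((norm (z + \<i>))\<^sup>2 - (norm (z - \<i>))\<^sup>2) / (norm (z + \<i>))\<^sup>2"
    using plus_i_nonzero[OF assms] by (simp add: diff_divide_distrib)
  ultimately show ?thesis by simp
qed

lemma hyp_length_cayley:
  assumes "Im z > 0"
  shows "hyp_length_disc (cayley z) (deriv cayley z * v) = hyp_length_half z v"
  using plus_i_nonzero[OF assms] assms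
  unfolding hyp_length_disc_def hyp_length_half_def one_minus_norm_cayley[OF assms] deriv_cayley[OF assms]
  by (simp add: norm_mult norm_divide norm_power)

text \<open>The Cayley map sends infinity to 1, so horodiscs at 1 correspond to half-planes bounded
  below by horizontal lines.\<close>

lemma horo_radius_cayley:
  assumes "Im z > 0"
  shows "horo_radius_disc (cayley z) = horo_radius_half z"
  using plus_i_nonzero[OF assms] assms
  unfolding horo_radius_disc_def horo_radius_half_def one_minus_norm_cayley[OF assms] one_minus_cayley[OF assms]
  by (simp add: norm_mult norm_divide power_divide)

section \<open>Pullback of semigroups and generators\<close>

lemma semigroup_pullback_cayley:
  assumes sg: "continuous_semigroup unit_disc \<Phi>"
  shows "continuous_semigroup upper_half (\<lambda>t z. cayley_inv (\<Phi> t (cayley z)))"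
  unfolding continuous_semigroup_def
proof (intro conjI allI impI ballI)
  have inD: "norm (\<Phi> t (cayley z)) < 1" if "t \<ge> 0" "Im z > 0" for t z
    using semigroup_maps[OF sg that(1)] cayley_in_unit_disc[OF that(2)] by auto
  fix t :: real assume t: "t \<ge> 0"
  have "(\<Phi> t \<circ> cayley) holomorphic_on upper_half"
    by (rule holomorphic_on_compose_gen[OF holomorphic_cayley semigroup_holomorphic[OF sg t]])
      (auto simp: cayley_in_unit_disc)
  from holomorphic_on_compose_gen[OF this holomorphic_cayley_inv]
  show "(\<lambda>z. cayley_inv (\<Phi> t (cayley z))) holomorphic_on upper_half"
    using inD[OF t] by (auto simp: o_def)
  show "(\<lambda>z. cayley_inv (\<Phi> t (cayley z))) ` upper_half \<subseteq> upper_half"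
    using inD[OF t] cayley_inv_in_upper_half by auto
  fix s :: real and z assume s: "s \<ge> 0" and z: "z \<in> upper_half"
  show "cayley_inv (\<Phi> (s + t) (cayley z)) = cayley_inv (\<Phi> s (cayley (cayley_inv (\<Phi> t (cayley z)))))"
    using z t s inD[OF t, of z] cayley_in_unit_disc[of z]
    by (simp add: cayley_cayley_inv semigroup_add[OF sg])
next
  fix z assume "z \<in> upper_half"
  then show "cayley_inv (\<Phi> 0 (cayley z)) = z"
    using cayley_in_unit_disc[of z] by (simp add: semigroup_0[OF sg] cayley_inv_cayley)
next
  fix K assume "compact K \<and> K \<subseteq> upper_half"
  then have K: "compact K" "K \<subseteq> upper_half" by auto
  have contC: "continuous_on K cayley"
    using holomorphic_on_imp_continuous_on[OF holomorphic_cayley] K(2) continuous_on_subset by blast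
  have "compact (cayley ` K)" by (rule compact_continuous_image[OF contC K(1)])
  then have "uniform_limit (cayley ` K) \<Phi> (\<lambda>z. z) (at_right 0)"
    using K(2) cayley_in_unit_disc by (intro semigroup_uniform_limit[OF sg]) auto
  then have lim: "uniform_limit K (\<lambda>t z. \<Phi> t (cayley z)) (\<lambda>z. cayley z) (at_right 0)"
    by (rule uniform_limit_compose') auto
  \<comment> \<open>\<open>cayley_inv\<close> has a pole at 1; staying away from it on
    \<open>K\<close> makes the quotient converge uniformly.\<close>
  obtain b where b: "b > 0" "\<And>z. z \<in> K \<Longrightarrow> b \<le> norm (1 - cayley z)"
  proof (cases "K = {}")
    case False
    have "continuous_on K (\<lambda>z. norm (1 - cayley z))" by (intro continuous_intros contC)
    then obtain z where z: "z \<in> K" "\<forall>x\<in>K. norm (1 - cayley z) \<le> norm (1 - cayley x)"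
      using continuous_attains_inf[OF K(1) False] by blast
    moreover have "norm (1 - cayley z) > 0" using cayley_in_unit_disc[of z] K(2) z(1) by auto
    ultimately show ?thesis using that by blast
  qed (use that[of 1] in auto)
  have "uniform_limit K (\<lambda>t z. \<i> * (1 + \<Phi> t (cayley z)) / (1 - \<Phi> t (cayley z)))
      (\<lambda>z. \<i> * (1 + cayley z) / (1 - cayley z)) (at_right 0)"
  proof (rule uniform_lim_divide)
    show "uniform_limit K (\<lambda>t z. \<i> * (1 + \<Phi> t (cayley z))) (\<lambda>z. \<i> * (1 + cayley z)) (at_right 0)"
      "uniform_limit K (\<lambda>t z. 1 - \<Phi> t (cayley z)) (\<lambda>z. 1 - cayley z) (at_right 0)"
      by (intro uniform_limit_intros lim)+
    show "bounded ((\<lambda>z. \<i> * (1 + cayley z)) ` K)"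
      by (intro compact_imp_bounded compact_continuous_image continuous_intros contC K(1))
  qed (use b in auto)
  moreover have "\<i> * (1 + cayley z) / (1 - cayley z) = z" if "z \<in> K" for z
    using cayley_inv_cayley[of z] K(2) that by (auto simp: cayley_inv_def)
  ultimately show "uniform_limit K (\<lambda>t z. cayley_inv (\<Phi> t (cayley z))) (\<lambda>z. z) (at_right 0)"
    unfolding cayley_inv_def by (simp cong: uniform_limit_cong')
qed

lemma Inf_gen_pullback_cayley:
  assumes "G \<in> Inf_gen unit_disc"
  shows "(\<lambda>z. G (cayley z) / deriv cayley z) \<in> Inf_gen upper_half"
proof -
  obtain \<Phi> where sg: "continuous_semigroup unit_disc \<Phi>" and gen: "is_generator unit_disc \<Phi> G"
    using assms unfolding Inf_gen_def by blast
  have "(G \<circ> cayley) holomorphic_on upper_half"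
    by (rule holomorphic_on_compose_gen[OF holomorphic_cayley])
      (use gen cayley_in_unit_disc in \<open>auto simp: is_generator_def\<close>)
  then have "(\<lambda>z. G (cayley z)) holomorphic_on upper_half" by (simp add: o_def)
  moreover have "deriv cayley holomorphic_on upper_half"
    by (intro holomorphic_deriv holomorphic_cayley open_halfspace_Im_gt)
  moreover have "deriv cayley z \<noteq> 0" if "Im z > 0" for z
    using plus_i_nonzero[OF that] by (simp add: deriv_cayley[OF that])
  ultimately have hol: "(\<lambda>z. G (cayley z) / deriv cayley z) holomorphic_on upper_half"
    by (intro holomorphic_on_divide) auto
  have "((\<lambda>t. (cayley_inv (\<Phi> t (cayley z)) - z) / of_real t) \<longlongrightarrow> G (cayley z) / deriv cayley z) (at_right 0)"
    if z: "Im z > 0" for z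
  proof -
    define w where "w = cayley z"
    have w: "w \<in> unit_disc" using cayley_in_unit_disc[OF z] by (simp add: w_def)
    then have "w \<noteq> 1" by auto
    have zw: "z = cayley_inv w" by (simp add: w_def cayley_inv_cayley[OF z])
    have "((\<lambda>t. (\<Phi> t w - w) / of_real t) \<longlongrightarrow> G w) (at_right 0)"
      using gen w by (simp add: is_generator_def)
    then have "((\<lambda>t. 2 * \<i> * ((\<Phi> t w - w) / of_real t) / ((1 - \<Phi> t w) * (1 - w))) \<longlongrightarrow>
        2 * \<i> * G w / ((1 - w) * (1 - w))) (at_right 0)"
      using \<open>w \<noteq> 1\<close> by (intro tendsto_intros semigroup_tendsto_0[OF sg w]) auto
    moreover have "\<forall>\<^sub>F t in at_right 0. 2 * \<i> * ((\<Phi> t w - w) / of_real t) / ((1 - \<Phi> t w) * (1 - w))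
        = (cayley_inv (\<Phi> t w) - cayley_inv w) / of_real t"
      using eventually_at_right_less
    proof eventually_elim
      case (elim t)
      have "\<Phi> t w \<in> unit_disc" using semigroup_maps[OF sg, of t] elim w by auto
      then have "\<Phi> t w \<noteq> 1" by auto
      then show ?case by (simp add: cayley_inv_diff \<open>w \<noteq> 1\<close>)
    qed
    ultimately have "((\<lambda>t. (cayley_inv (\<Phi> t w) - cayley_inv w) / of_real t) \<longlongrightarrow>
        2 * \<i> * G w / ((1 - w) * (1 - w))) (at_right 0)"
      by (rule Lim_transform_eventually)
    \<comment> \<open>The derivative of the inverse Cayley map at \<open>w\<close> is 2i / (1 -
      w)^2, the reciprocal of \<open>deriv cayley z\<close>.\<close>
    moreover have "2 * \<i> * G w / ((1 - w) * (1 - w)) = G w / deriv cayley z"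
      using plus_i_nonzero[OF z]
      by (simp add: w_def one_minus_cayley[OF z] deriv_cayley[OF z] power2_eq_square field_simps)
    ultimately show ?thesis by (simp add: w_def cayley_inv_cayley[OF z])
  qed
  then have "is_generator upper_half (\<lambda>t z. cayley_inv (\<Phi> t (cayley z))) (\<lambda>z. G (cayley z) / deriv cayley z)"
    using hol by (simp add: is_generator_def)
  then show ?thesis
    using semigroup_pullback_cayley[OF sg] unfolding Inf_gen_def by blast
qed

section \<open>The two equivalences\<close>

lemma hyp_length_half_bound_iff:
  assumes "Im z > 0"
  shows "hyp_length_half z v \<le> c * (horo_radius_half z)\<^sup>2 \<longleftrightarrow> norm v \<le> c / Im z"
  using assms by (simp add: hyp_length_half_def horo_radius_half_def power2_eq_square field_simps)

lemma K_half_iff: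
  assumes "c \<ge> 0" "H \<in> Inf_gen upper_half"
  shows "H \<in> K_half c \<longleftrightarrow> (\<forall>z\<in>upper_half. hyp_length_half z (H z) \<le> c * (horo_radius_half z)\<^sup>2)"
  using K_half_imp_bound bound_imp_K_half[OF assms(2,1)] by (auto simp: hyp_length_half_bound_iff)

text \<open>Forward, the half-plane bound for the given witness \<open>H'\<close> is carried over by
  invariance of length and horodisc radius. Backward, the pullback \<open>H\<close> of
  \<open>G\<close> is a generator that inherits the bound and serves as the witness.\<close>

lemma K_disc_iff:
  assumes c: "c \<ge> 0" and G: "G \<in> Inf_gen unit_disc"
  shows "G \<in> K_disc c \<longleftrightarrow> (\<forall>z\<in>unit_disc. hyp_length_disc z (G z) \<le> c * (horo_radius_disc z)\<^sup>2)"
proof -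
  define H where "H z = G (cayley z) / deriv cayley z" for z
  have H: "H \<in> Inf_gen upper_half"
    using Inf_gen_pullback_cayley[OF G] by (simp add: H_def[abs_def])
  have d: "deriv cayley z \<noteq> 0" if "Im z > 0" for z
    using plus_i_nonzero[OF that] by (simp add: deriv_cayley[OF that])
  have GH: "G (cayley z) = deriv cayley z * H z" if "Im z > 0" for z
    using d[OF that] by (simp add: H_def)
  show ?thesis
  proof
    assume "G \<in> K_disc c"
    then obtain H' where H': "H' \<in> K_half c" "\<And>w. w \<in> unit_disc \<Longrightarrow>
        G w = deriv cayley (inv_into upper_half cayley w) * H' (inv_into upper_half cayley w)"
      unfolding K_disc_def by blast
    show "\<forall>w\<in>unit_disc. hyp_length_disc w (G w) \<le> c * (horo_radius_disc w)\<^sup>2"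
    proof
      fix w assume "w \<in> unit_disc"
      then obtain z where z: "Im z > 0" "w = cayley z" using unit_disc_cayleyE by auto
      have "G w = deriv cayley z * H' z"
        using H'(2)[OF \<open>w \<in> unit_disc\<close>] by (simp add: z inv_into_cayley)
      then show "hyp_length_disc w (G w) \<le> c * (horo_radius_disc w)\<^sup>2"
        using K_half_imp_bound[OF H'(1) z(1)]
        by (simp add: z hyp_length_cayley horo_radius_cayley hyp_length_half_bound_iff)
    qed
  next
    assume b: "\<forall>w\<in>unit_disc. hyp_length_disc w (G w) \<le> c * (horo_radius_disc w)\<^sup>2"
    have "norm (H z) \<le> c / Im z" if z: "Im z > 0" for z
      using b cayley_in_unit_disc[OF z] GH[OF z] z
      by (force simp: hyp_length_cayley horo_radius_cayley simp flip: hyp_length_half_bound_iff)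
    then have "H \<in> K_half c" by (rule bound_imp_K_half[OF H c])
    moreover have "G w = deriv cayley (inv_into upper_half cayley w) * H (inv_into upper_half cayley w)"
      if "w \<in> unit_disc" for w
    proof -
      obtain z where z: "Im z > 0" "w = cayley z" using \<open>w \<in> unit_disc\<close> unit_disc_cayleyE by auto
      then show ?thesis using GH[OF z(1)] by (simp add: inv_into_cayley)
    qed
    ultimately show "G \<in> K_disc c" unfolding K_disc_def by blast
  qed
qed

theorem proposition2p1:
  fixes c :: real
  assumes "c \<ge> 0"
  shows "(\<forall>G \<in> Inf_gen unit_disc.
            G \<in> K_disc c \<longleftrightarrow>
            (\<forall>z\<in>unit_disc. hyp_length_disc z (G z) \<le> c * (horo_radius_disc z)\<^sup>2)) \<and>
         (\<forall>H \<in> Inf_gen upper_half.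
            H \<in> K_half c \<longleftrightarrow>
            (\<forall>z\<in>upper_half. hyp_length_half z (H z) \<le> c * (horo_radius_half z)\<^sup>2))"
  using K_disc_iff[OF assms] K_half_iff[OF assms] by blast

end
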